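(* Let $T$ be one of $C_3,C_4,C_6,C_7,C_8,C_9,C_{10},C_{12},C_2\times C_2,C_2\times C_4,C_2\times C_6,C_2\times C_8$. Let $P_0^T=(a_0,b_0,c_0)$ be a good positive $ABC$ triple with $a_0\equiv 0\bmod 6$ and $\frac{b_0}{a_0}>\delta_T$, where $\delta_T$ is defined in the context. Define $P_n^T$ for $n\ge 1$ recursively by $$P_n^T=(a_n,b_n,c_n)=\left(1728D_T(a_{n-1},b_{n-1}),\,B_T(a_{n-1},b_{n-1})^2,\,A_T(a_{n-1},b_{n-1})^3\right).$$ Assume further that $a_0\equiv 0\bmod 5$ if $T=C_{10}$ and that $a_0\equiv 0\bmod 7$ if $T=C_7$. Then the following hold for each $n\ge 0$: (1) $\frac{b_n}{a_n}>\delta_T$; (2) $a_n\equiv 0\bmod 6$; (3) $a_n\equiv 0\bmod 5$ if $T=C_{10}$, and $a_n\equiv 0\bmod 7$ if $T=C_7$; (4) $P_n^T=(a_n,b_n,c_n)$ is a good positive $ABC$ triple.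
   Context: $C_m$ is the cyclic group of order $m$ (here $T$ serves only as an index). An $ABC$ triple is a triple $(a,b,c)$ of integers with $a+b=c$ and $\gcd(a,b,c)=1$; it is positive if $a,b,c>0$, and good if $\operatorname{rad}(abc)<\max\{|a|,|b|,|c|\}$, where $\operatorname{rad}(n)$ is the product of the distinct primes dividing $n$. Polynomials $A_T=A_T(a,b)$: - $C_3$: $(a^3-3a^2b-6ab^2-b^3)(a^3+3a^2b-b^3)(a^6+12a^5b+69a^4b^2+88a^3b^3+24a^2b^4-6ab^5+b^6)$. - $C_4$: $(a^4-2a^3b-2ab^3+b^4)(a^{12}-6a^{11}b+12a^{10}b^2-14a^9b^3+243a^8b^4-468a^7b^5+456a^6b^6-468a^5b^7+243a^4b^8-14a^3b^9+12a^2b^{10}-6ab^{11}+b^{12})$. - $C_6$: $(a^4+4a^3b-6a^2b^2+4ab^3+b^4)(a^{12}-12a^{11}b+78a^{10}b^2-188a^9b^3+111a^8b^4+264a^7b^5-444a^6b^6+264a^5b^7+111a^4b^8-188a^3b^9+78a^2b^{10}-12ab^{11}+b^{12})$. - $C_7$: $(a^2+ab+b^2)(a^6+11a^5b+30a^4b^2+15a^3b^3-10a^2b^4-5ab^5+b^6)$. - $C_8$: $a^{16}-8a^{14}b^2+12a^{12}b^4+8a^{10}b^6-10a^8b^8+8a^6b^{10}+12a^4b^{12}-8a^2b^{14}+b^{16}$. - $C_9$: $(a^3+3a^2b-b^3)(a^9+9a^8b+27a^7b^2+48a^6b^3+54a^5b^4+45a^4b^5+27a^3b^6+9a^2b^7-b^9)$.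 - $C_{10}$: $\frac1{16}(a^{12}+16a^{11}b+104a^{10}b^2+360a^9b^3+720a^8b^4+816a^7b^5+416a^6b^6-96a^5b^7-240a^4b^8-80a^3b^9+64a^2b^{10}+64ab^{11}+16b^{12})$. - $C_{12}$: $(a^4-2a^3b-2ab^3+b^4)(a^{12}-6a^{11}b+12a^{10}b^2-14a^9b^3+3a^8b^4+12a^7b^5-24a^6b^6+12a^5b^7+3a^4b^8-14a^3b^9+12a^2b^{10}-6ab^{11}+b^{12})$. - $C_2\times C_2$: $a^{16}+232a^{14}b^2+732a^{12}b^4-1192a^{10}b^6+710a^8b^8-1192a^6b^{10}+732a^4b^{12}+232a^2b^{14}+b^{16}$. - $C_2\times C_4$: $(a^8-4a^7b+4a^6b^2+28a^5b^3+6a^4b^4-28a^3b^5+4a^2b^6+4ab^7+b^8)(a^8+4a^7b+4a^6b^2-28a^5b^3+6a^4b^4+28a^3b^5+4a^2b^6-4ab^7+b^8)$. - $C_2\times C_6$: $(a^4-2a^3b+6a^2b^2-2ab^3+b^4)(a^{12}-6a^{11}b+6a^{10}b^2+10a^9b^3+15a^8b^4-36a^7b^5+84a^6b^6-36a^5b^7+15a^4b^8+10a^3b^9+6a^2b^{10}-6ab^{11}+b^{12})$. - $C_2\times C_8$: $a^{16}-8a^{14}b^2+12a^{12}b^4+8a^{10}b^6+230a^8b^8+8a^6b^{10}+12a^4b^{12}-8a^2b^{14}+b^{16}$. Polynomials $B_T=B_T(a,b)$: - $C_3$: $-(a^6+12a^5b+15a^4b^2-20a^3b^3-30a^2b^4-6ab^5+b^6)(a^{12}+6a^{11}b+48a^{10}b^2+428a^9b^3+1899a^8b^4+3636a^7b^5+3030a^6b^6+720a^5b^7-288a^4b^8-58a^3b^9+48a^2b^{10}+6ab^{11}+b^{12})$.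 - $C_4$: $-(a^8-4a^7b+28a^6b^2-52a^5b^3+46a^4b^4-52a^3b^5+28a^2b^6-4ab^7+b^8)(a^{16}-8a^{15}b+104a^{13}b^3-220a^{12}b^4+216a^{11}b^5-728a^{10}b^6+1144a^9b^7-1026a^8b^8+1144a^7b^9-728a^6b^{10}+216a^5b^{11}-220a^4b^{12}+104a^3b^{13}-8ab^{15}+b^{16})$. - $C_6$: $-(a^8-4a^7b+4a^6b^2+20a^5b^3-26a^4b^4+20a^3b^5+4a^2b^6-4ab^7+b^8)(a^{16}-8a^{15}b+24a^{14}b^2-568a^{13}b^3+2684a^{12}b^4-4776a^{11}b^5+2344a^{10}b^6+4840a^9b^7-8826a^8b^8+4840a^7b^9+2344a^6b^{10}-4776a^5b^{11}+2684a^4b^{12}-568a^3b^{13}+24a^2b^{14}-8ab^{15}+b^{16})$. - $C_7$: $-(a^{12}+18a^{11}b+117a^{10}b^2+354a^9b^3+570a^8b^4+486a^7b^5+273a^6b^6+222a^5b^7+174a^4b^8+46a^3b^9-15a^2b^{10}-6ab^{11}+b^{12})$. - $C_8$: $-(a^8-4a^6b^2-2a^4b^4-4a^2b^6+b^8)(a^{16}-8a^{14}b^2+12a^{12}b^4+8a^{10}b^6-34a^8b^8+8a^6b^{10}+12a^4b^{12}-8a^2b^{14}+b^{16})$. - $C_9$: $-(a^{18}+18a^{17}b+135a^{16}b^2+570a^{15}b^3+1557a^{14}b^4+2970a^{13}b^5+4128a^{12}b^6+4230a^{11}b^7+3240a^{10}b^8+2032a^9b^9+1359a^8b^{10}+1080a^7b^{11}+735a^6b^{12}+306a^5b^{13}+27a^4b^{14}-42a^3b^{15}-18a^2b^{16}+b^{18})$.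 - $C_{10}$: $-\frac1{64}(a^2+2ab+2b^2)(a^4+6a^3b+6a^2b^2-4ab^3-4b^4)(a^4+6a^3b+12a^2b^2+8ab^3+2b^4)(a^8+10a^7b+32a^6b^2+40a^5b^3+14a^4b^4+8a^2b^6-4b^8)$. - $C_{12}$: $-(a^8-4a^7b+4a^6b^2-4a^5b^3-2a^4b^4-4a^3b^5+4a^2b^6-4ab^7+b^8)(a^{16}-8a^{15}b+24a^{14}b^2-40a^{13}b^3+44a^{12}b^4-24a^{11}b^5-32a^{10}b^6+88a^9b^7-114a^8b^8+88a^7b^9-32a^6b^{10}-24a^5b^{11}+44a^4b^{12}-40a^3b^{13}+24a^2b^{14}-8ab^{15}+b^{16})$. - $C_2\times C_2$: $-(a^8+20a^6b^2-26a^4b^4+20a^2b^6+b^8)(a^8-24a^7b+20a^6b^2-24a^5b^3-26a^4b^4+24a^3b^5+20a^2b^6+24ab^7+b^8)(a^8+24a^7b+20a^6b^2+24a^5b^3-26a^4b^4-24a^3b^5+20a^2b^6-24ab^7+b^8)$. - $C_2\times C_4$: $-(a^4-4a^3b-6a^2b^2+4ab^3+b^4)(a^4+4a^3b-6a^2b^2-4ab^3+b^4)(a^8-4a^6b^2+22a^4b^4-4a^2b^6+b^8)(a^8+20a^6b^2-26a^4b^4+20a^2b^6+b^8)$. - $C_2\times C_6$: $-(a^8-4a^7b+4a^6b^2-28a^5b^3+22a^4b^4-28a^3b^5+4a^2b^6-4ab^7+b^8)(a^8-4a^7b+4a^6b^2-4a^5b^3-2a^4b^4-4a^3b^5+4a^2b^6-4ab^7+b^8)(a^8-4a^7b+4a^6b^2+20a^5b^3-26a^4b^4+20a^3b^5+4a^2b^6-4ab^7+b^8)$.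 - $C_2\times C_8$: $-(a^8-4a^6b^2-26a^4b^4-4a^2b^6+b^8)(a^8-4a^6b^2-2a^4b^4-4a^2b^6+b^8)(a^8-4a^6b^2+22a^4b^4-4a^2b^6+b^8)$. Polynomials $D_T=D_T(a,b)$: - $C_3$: $-a^3b^3(a+b)^3(a^2+ab+b^2)^9(a^3+6a^2b+3ab^2-b^3)^3$. - $C_4$: $a^4b^4(a+b)^6(a-b)^2(a^2+b^2)(a^2-4ab+b^2)^3(a^2-ab+b^2)^{12}$. - $C_6$: $a^3b^3(a+b)^2(a-b)^6(a^2-ab+b^2)(a^2-4ab+b^2)^4(a^2+b^2)^{12}$. - $C_7$: $-a^7b^7(a+b)^7(a^3+8a^2b+5ab^2-b^3)$. - $C_8$: $a^{16}b^{16}(a+b)^4(a-b)^4(a^2-2ab-b^2)(a^2+2ab-b^2)(a^2+b^2)^2$. - $C_9$: $-a^9b^9(a+b)^9(a^2+ab+b^2)^3(a^3+6a^2b+3ab^2-b^3)$. - $C_{10}$: $\frac{1}{4096}a^5b^{10}(a+b)^{10}(a+2b)^5(a^2+6ab+4b^2)(a^2+ab-b^2)^2$. - $C_{12}$: $a^{12}b^{12}(a+b)^2(a-b)^6(a^2-4ab+b^2)(a^2+b^2)^3(a^2-ab+b^2)^4$. - $C_2\times C_2$: $a^2b^2(a+b)^2(a-b)^2(a^2+b^2)^4(a^2-2ab-b^2)^8(a^2+2ab-b^2)^8$. - $C_2\times C_4$: $a^4b^4(a+b)^4(a-b)^4(a^2-2ab-b^2)^4(a^2+2ab-b^2)^4(a^2+b^2)^8$.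 - $C_2\times C_6$: $a^6b^6(a+b)^4(a-b)^{12}(a^2-4ab+b^2)^2(a^2-ab+b^2)^2(a^2+b^2)^6$. - $C_2\times C_8$: $a^8b^8(a+b)^8(a-b)^8(a^2-2ab-b^2)^2(a^2+2ab-b^2)^2(a^2+b^2)^4$. Constants: let $\theta_T=\max\{x\in\mathbb{R}: D_T(1,x)=0\}$, and define $f_T:(\theta_T,\infty)\to\mathbb{R}$ by $f_T(x)=\dfrac{B_T(1,x)^2}{1728D_T(1,x)}-x$. Then $\delta_T=\max\{x\in(\theta_T,\infty): f_T(x)=0\}$. Approximate values of $\delta_T$: $C_3$: $43.4033$; $C_4$: $13.5934$; $C_6$: $43.3677$; $C_7$: $7.07956$; $C_8$: $2.48383$; $C_9$: $4.75552$; $C_{10}$: $3.06311$; $C_{12}$: $3.89418$; $C_2\times C_2$: $1728.57$; $C_2\times C_4$: $12.2907$; $C_2\times C_6$: $6.00485$; $C_2\times C_8$: $3.38169$. *)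

theory Defs
  imports Complex_Main "HOL-Computational_Algebra.Primes" "HOL-Number_Theory.Cong"
begin

text \<open>
  The value on 0 is an artefact of \<^term>\<open>prime_factors 0 = {}\<close>; below it is only ever relevant for
  products of three positive integers.
\<close>
definition rad :: "int \<Rightarrow> int" where
  "rad n = \<Prod>(prime_factors n)"

definition abc_triple :: "int \<Rightarrow> int \<Rightarrow> int \<Rightarrow> bool" where
  "abc_triple a b c \<longleftrightarrow> a + b = c \<and> gcd a (gcd b c) = 1"

definition positive_abc_triple :: "int \<Rightarrow> int \<Rightarrow> int \<Rightarrow> bool" where
  "positive_abc_triple a b c \<longleftrightarrow> abc_triple a b c \<and> a > 0 \<and> b > 0 \<and> c > 0"

definition good_abc_triple :: "int \<Rightarrow> int \<Rightarrow> int \<Rightarrow> bool" where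
  "good_abc_triple a b c \<longleftrightarrow> abc_triple a b c \<and> rad (a * b * c) < Max {\<bar>a\<bar>, \<bar>b\<bar>, \<bar>c\<bar>}"

text \<open>The cyclic groups and products of two cyclic groups serve only as indices.\<close>
datatype torsion = C3 | C4 | C6 | C7 | C8 | C9 | C10 | C12 | C2xC2 | C2xC4 | C2xC6 | C2xC8

fun A_poly :: "torsion \<Rightarrow> real \<Rightarrow> real \<Rightarrow> real" where
  "A_poly C3 a b =
     (a^3 - 3 * a^2 * b - 6 * a * b^2 - b^3) * (a^3 + 3 * a^2 * b - b^3)
       * (a^6 + 12 * a^5 * b + 69 * a^4 * b^2 + 88 * a^3 * b^3 + 24 * a^2 * b^4 - 6 * a * b^5
           + b^6)" |
  "A_poly C4 a b =
     (a^4 - 2 * a^3 * b - 2 * a * b^3 + b^4)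
       * (a^12 - 6 * a^11 * b + 12 * a^10 * b^2 - 14 * a^9 * b^3 + 243 * a^8 * b^4
           - 468 * a^7 * b^5 + 456 * a^6 * b^6 - 468 * a^5 * b^7 + 243 * a^4 * b^8 - 14 * a^3 * b^9
           + 12 * a^2 * b^10 - 6 * a * b^11 + b^12)" |
  "A_poly C6 a b =
     (a^4 + 4 * a^3 * b - 6 * a^2 * b^2 + 4 * a * b^3 + b^4)
       * (a^12 - 12 * a^11 * b + 78 * a^10 * b^2 - 188 * a^9 * b^3 + 111 * a^8 * b^4
           + 264 * a^7 * b^5 - 444 * a^6 * b^6 + 264 * a^5 * b^7 + 111 * a^4 * b^8
           - 188 * a^3 * b^9 + 78 * a^2 * b^10 - 12 * a * b^11 + b^12)" |
  "A_poly C7 a b =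
     (a^2 + a * b + b^2)
       * (a^6 + 11 * a^5 * b + 30 * a^4 * b^2 + 15 * a^3 * b^3 - 10 * a^2 * b^4 - 5 * a * b^5
           + b^6)" |
  "A_poly C8 a b =
     a^16 - 8 * a^14 * b^2 + 12 * a^12 * b^4 + 8 * a^10 * b^6 - 10 * a^8 * b^8
           + 8 * a^6 * b^10 + 12 * a^4 * b^12 - 8 * a^2 * b^14 + b^16" |
  "A_poly C9 a b =
     (a^3 + 3 * a^2 * b - b^3)
       * (a^9 + 9 * a^8 * b + 27 * a^7 * b^2 + 48 * a^6 * b^3 + 54 * a^5 * b^4 + 45 * a^4 * b^5
           + 27 * a^3 * b^6 + 9 * a^2 * b^7 - b^9)" |
  "A_poly C10 a b =
     1 / 16 * (a^12 + 16 * a^11 * b + 104 * a^10 * b^2 + 360 * a^9 * b^3 + 720 * a^8 * b^4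
           + 816 * a^7 * b^5 + 416 * a^6 * b^6 - 96 * a^5 * b^7 - 240 * a^4 * b^8 - 80 * a^3 * b^9
           + 64 * a^2 * b^10 + 64 * a * b^11 + 16 * b^12)" |
  "A_poly C12 a b =
     (a^4 - 2 * a^3 * b - 2 * a * b^3 + b^4)
       * (a^12 - 6 * a^11 * b + 12 * a^10 * b^2 - 14 * a^9 * b^3 + 3 * a^8 * b^4
           + 12 * a^7 * b^5 - 24 * a^6 * b^6 + 12 * a^5 * b^7 + 3 * a^4 * b^8 - 14 * a^3 * b^9
           + 12 * a^2 * b^10 - 6 * a * b^11 + b^12)" |
  "A_poly C2xC2 a b =
     a^16 + 232 * a^14 * b^2 + 732 * a^12 * b^4 - 1192 * a^10 * b^6 + 710 * a^8 * b^8
           - 1192 * a^6 * b^10 + 732 * a^4 * b^12 + 232 * a^2 * b^14 + b^16" |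
  "A_poly C2xC4 a b =
     (a^8 - 4 * a^7 * b + 4 * a^6 * b^2 + 28 * a^5 * b^3 + 6 * a^4 * b^4 - 28 * a^3 * b^5
           + 4 * a^2 * b^6 + 4 * a * b^7 + b^8)
       * (a^8 + 4 * a^7 * b + 4 * a^6 * b^2 - 28 * a^5 * b^3 + 6 * a^4 * b^4 + 28 * a^3 * b^5
           + 4 * a^2 * b^6 - 4 * a * b^7 + b^8)" |
  "A_poly C2xC6 a b =
     (a^4 - 2 * a^3 * b + 6 * a^2 * b^2 - 2 * a * b^3 + b^4)
       * (a^12 - 6 * a^11 * b + 6 * a^10 * b^2 + 10 * a^9 * b^3 + 15 * a^8 * b^4
           - 36 * a^7 * b^5 + 84 * a^6 * b^6 - 36 * a^5 * b^7 + 15 * a^4 * b^8 + 10 * a^3 * b^9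
           + 6 * a^2 * b^10 - 6 * a * b^11 + b^12)" |
  "A_poly C2xC8 a b =
     a^16 - 8 * a^14 * b^2 + 12 * a^12 * b^4 + 8 * a^10 * b^6 + 230 * a^8 * b^8
           + 8 * a^6 * b^10 + 12 * a^4 * b^12 - 8 * a^2 * b^14 + b^16"

fun B_poly :: "torsion \<Rightarrow> real \<Rightarrow> real \<Rightarrow> real" where
  "B_poly C3 a b =
     - ((a^6 + 12 * a^5 * b + 15 * a^4 * b^2 - 20 * a^3 * b^3 - 30 * a^2 * b^4 - 6 * a * b^5
           + b^6)
       * (a^12 + 6 * a^11 * b + 48 * a^10 * b^2 + 428 * a^9 * b^3 + 1899 * a^8 * b^4
           + 3636 * a^7 * b^5 + 3030 * a^6 * b^6 + 720 * a^5 * b^7 - 288 * a^4 * b^8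
           - 58 * a^3 * b^9 + 48 * a^2 * b^10 + 6 * a * b^11 + b^12))" |
  "B_poly C4 a b =
     - ((a^8 - 4 * a^7 * b + 28 * a^6 * b^2 - 52 * a^5 * b^3 + 46 * a^4 * b^4 - 52 * a^3 * b^5
           + 28 * a^2 * b^6 - 4 * a * b^7 + b^8)
       * (a^16 - 8 * a^15 * b + 104 * a^13 * b^3 - 220 * a^12 * b^4 + 216 * a^11 * b^5
           - 728 * a^10 * b^6 + 1144 * a^9 * b^7 - 1026 * a^8 * b^8 + 1144 * a^7 * b^9
           - 728 * a^6 * b^10 + 216 * a^5 * b^11 - 220 * a^4 * b^12 + 104 * a^3 * b^13
           - 8 * a * b^15 + b^16))" |
  "B_poly C6 a b =
     - ((a^8 - 4 * a^7 * b + 4 * a^6 * b^2 + 20 * a^5 * b^3 - 26 * a^4 * b^4 + 20 * a^3 * b^5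
           + 4 * a^2 * b^6 - 4 * a * b^7 + b^8)
       * (a^16 - 8 * a^15 * b + 24 * a^14 * b^2 - 568 * a^13 * b^3 + 2684 * a^12 * b^4
           - 4776 * a^11 * b^5 + 2344 * a^10 * b^6 + 4840 * a^9 * b^7 - 8826 * a^8 * b^8
           + 4840 * a^7 * b^9 + 2344 * a^6 * b^10 - 4776 * a^5 * b^11 + 2684 * a^4 * b^12
           - 568 * a^3 * b^13 + 24 * a^2 * b^14 - 8 * a * b^15 + b^16))" |
  "B_poly C7 a b =
     - ((a^12 + 18 * a^11 * b + 117 * a^10 * b^2 + 354 * a^9 * b^3 + 570 * a^8 * b^4
           + 486 * a^7 * b^5 + 273 * a^6 * b^6 + 222 * a^5 * b^7 + 174 * a^4 * b^8 + 46 * a^3 * b^9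
           - 15 * a^2 * b^10 - 6 * a * b^11 + b^12))" |
  "B_poly C8 a b =
     - ((a^8 - 4 * a^6 * b^2 - 2 * a^4 * b^4 - 4 * a^2 * b^6 + b^8)
       * (a^16 - 8 * a^14 * b^2 + 12 * a^12 * b^4 + 8 * a^10 * b^6 - 34 * a^8 * b^8
           + 8 * a^6 * b^10 + 12 * a^4 * b^12 - 8 * a^2 * b^14 + b^16))" |
  "B_poly C9 a b =
     - ((a^18 + 18 * a^17 * b + 135 * a^16 * b^2 + 570 * a^15 * b^3 + 1557 * a^14 * b^4
           + 2970 * a^13 * b^5 + 4128 * a^12 * b^6 + 4230 * a^11 * b^7 + 3240 * a^10 * b^8
           + 2032 * a^9 * b^9 + 1359 * a^8 * b^10 + 1080 * a^7 * b^11 + 735 * a^6 * b^12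
           + 306 * a^5 * b^13 + 27 * a^4 * b^14 - 42 * a^3 * b^15 - 18 * a^2 * b^16 + b^18))" |
  "B_poly C10 a b =
     - (1 / 64 * (a^2 + 2 * a * b + 2 * b^2)
       * (a^4 + 6 * a^3 * b + 6 * a^2 * b^2 - 4 * a * b^3 - 4 * b^4)
       * (a^4 + 6 * a^3 * b + 12 * a^2 * b^2 + 8 * a * b^3 + 2 * b^4)
       * (a^8 + 10 * a^7 * b + 32 * a^6 * b^2 + 40 * a^5 * b^3 + 14 * a^4 * b^4 + 8 * a^2 * b^6
           - 4 * b^8))" |
  "B_poly C12 a b =
     - ((a^8 - 4 * a^7 * b + 4 * a^6 * b^2 - 4 * a^5 * b^3 - 2 * a^4 * b^4 - 4 * a^3 * b^5
           + 4 * a^2 * b^6 - 4 * a * b^7 + b^8)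
       * (a^16 - 8 * a^15 * b + 24 * a^14 * b^2 - 40 * a^13 * b^3 + 44 * a^12 * b^4
           - 24 * a^11 * b^5 - 32 * a^10 * b^6 + 88 * a^9 * b^7 - 114 * a^8 * b^8 + 88 * a^7 * b^9
           - 32 * a^6 * b^10 - 24 * a^5 * b^11 + 44 * a^4 * b^12 - 40 * a^3 * b^13
           + 24 * a^2 * b^14 - 8 * a * b^15 + b^16))" |
  "B_poly C2xC2 a b =
     - ((a^8 + 20 * a^6 * b^2 - 26 * a^4 * b^4 + 20 * a^2 * b^6 + b^8)
       * (a^8 - 24 * a^7 * b + 20 * a^6 * b^2 - 24 * a^5 * b^3 - 26 * a^4 * b^4
           + 24 * a^3 * b^5 + 20 * a^2 * b^6 + 24 * a * b^7 + b^8)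
       * (a^8 + 24 * a^7 * b + 20 * a^6 * b^2 + 24 * a^5 * b^3 - 26 * a^4 * b^4
           - 24 * a^3 * b^5 + 20 * a^2 * b^6 - 24 * a * b^7 + b^8))" |
  "B_poly C2xC4 a b =
     - ((a^4 - 4 * a^3 * b - 6 * a^2 * b^2 + 4 * a * b^3 + b^4)
       * (a^4 + 4 * a^3 * b - 6 * a^2 * b^2 - 4 * a * b^3 + b^4)
       * (a^8 - 4 * a^6 * b^2 + 22 * a^4 * b^4 - 4 * a^2 * b^6 + b^8)
       * (a^8 + 20 * a^6 * b^2 - 26 * a^4 * b^4 + 20 * a^2 * b^6 + b^8))" |
  "B_poly C2xC6 a b =
     - ((a^8 - 4 * a^7 * b + 4 * a^6 * b^2 - 28 * a^5 * b^3 + 22 * a^4 * b^4 - 28 * a^3 * b^5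
           + 4 * a^2 * b^6 - 4 * a * b^7 + b^8)
       * (a^8 - 4 * a^7 * b + 4 * a^6 * b^2 - 4 * a^5 * b^3 - 2 * a^4 * b^4 - 4 * a^3 * b^5
           + 4 * a^2 * b^6 - 4 * a * b^7 + b^8)
       * (a^8 - 4 * a^7 * b + 4 * a^6 * b^2 + 20 * a^5 * b^3 - 26 * a^4 * b^4 + 20 * a^3 * b^5
           + 4 * a^2 * b^6 - 4 * a * b^7 + b^8))" |
  "B_poly C2xC8 a b =
     - ((a^8 - 4 * a^6 * b^2 - 26 * a^4 * b^4 - 4 * a^2 * b^6 + b^8)
       * (a^8 - 4 * a^6 * b^2 - 2 * a^4 * b^4 - 4 * a^2 * b^6 + b^8)
       * (a^8 - 4 * a^6 * b^2 + 22 * a^4 * b^4 - 4 * a^2 * b^6 + b^8))"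

fun D_poly :: "torsion \<Rightarrow> real \<Rightarrow> real \<Rightarrow> real" where
  "D_poly C3 a b =
     - (a^3 * b^3 * (a + b)^3 * (a^2 + a * b + b^2)^9 * (a^3 + 6 * a^2 * b + 3 * a * b^2
           - b^3)^3)" |
  "D_poly C4 a b =
     a^4 * b^4 * (a + b)^6 * (a - b)^2 * (a^2 + b^2)
       * (a^2 - 4 * a * b + b^2)^3 * (a^2 - a * b + b^2)^12" |
  "D_poly C6 a b =
     a^3 * b^3 * (a + b)^2 * (a - b)^6 * (a^2 - a * b + b^2)
       * (a^2 - 4 * a * b + b^2)^4 * (a^2 + b^2)^12" |
  "D_poly C7 a b =
     - (a^7 * b^7 * (a + b)^7 * (a^3 + 8 * a^2 * b + 5 * a * b^2 - b^3))" |
  "D_poly C8 a b =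
     a^16 * b^16 * (a + b)^4 * (a - b)^4 * (a^2 - 2 * a * b - b^2)
       * (a^2 + 2 * a * b - b^2) * (a^2 + b^2)^2" |
  "D_poly C9 a b =
     - (a^9 * b^9 * (a + b)^9 * (a^2 + a * b + b^2)^3 * (a^3 + 6 * a^2 * b + 3 * a * b^2 - b^3))" |
  "D_poly C10 a b =
     1 / 4096 * a^5 * b^10 * (a + b)^10 * (a + 2 * b)^5 * (a^2 + 6 * a * b + 4 * b^2)
       * (a^2 + a * b - b^2)^2" |
  "D_poly C12 a b =
     a^12 * b^12 * (a + b)^2 * (a - b)^6 * (a^2 - 4 * a * b + b^2)
       * (a^2 + b^2)^3 * (a^2 - a * b + b^2)^4" |
  "D_poly C2xC2 a b =
     a^2 * b^2 * (a + b)^2 * (a - b)^2 * (a^2 + b^2)^4 * (a^2 - 2 * a * b - b^2)^8 * (a^2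
           + 2 * a * b - b^2)^8" |
  "D_poly C2xC4 a b =
     a^4 * b^4 * (a + b)^4 * (a - b)^4 * (a^2 - 2 * a * b - b^2)^4 * (a^2 + 2 * a * b
           - b^2)^4 * (a^2 + b^2)^8" |
  "D_poly C2xC6 a b =
     a^6 * b^6 * (a + b)^4 * (a - b)^12 * (a^2 - 4 * a * b + b^2)^2 * (a^2 - a * b
           + b^2)^2 * (a^2 + b^2)^6" |
  "D_poly C2xC8 a b =
     a^8 * b^8 * (a + b)^8 * (a - b)^8 * (a^2 - 2 * a * b - b^2)^2 * (a^2 + 2 * a * b
           - b^2)^2 * (a^2 + b^2)^4"

text \<open>
  For every index the two sets of zeros below are finite and non-empty, so \<^const>\<open>Max\<close> is a genuine
  maximum. The function \<open>f_T T\<close> is total here, but is meant on \<open>{theta_T T<..}\<close>, where its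
  denominator is nonzero.
\<close>
definition theta_T :: "torsion \<Rightarrow> real" where
  "theta_T T = Max {x. D_poly T 1 x = 0}"

definition f_T :: "torsion \<Rightarrow> real \<Rightarrow> real" where
  "f_T T x = (B_poly T 1 x)^2 / (1728 * D_poly T 1 x) - x"

definition delta_T :: "torsion \<Rightarrow> real" where
  "delta_T T = Max {x. x \<in> {theta_T T<..} \<and> f_T T x = 0}"

text \<open>
  The triples are taken over the reals because the polynomials of index \<^const>\<open>C10\<close> have
  non-integral coefficients, so integrality of the terms is not automatic.
\<close>
primrec P_seq :: "torsion \<Rightarrow> real \<times> real \<times> real \<Rightarrow> nat \<Rightarrow> real \<times> real \<times> real" where
  "P_seq T t 0 = t" |
  "P_seq T t (Suc n) =
     (case P_seq T t n of (a, b, c) \<Rightarrow>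
        (1728 * D_poly T a b, (B_poly T a b)^2, (A_poly T a b)^3))"

end

theory Submission
  imports Defs "HOL-Computational_Algebra.Polynomial"
begin

text \<open>
  One step \<open>(a, b, c) \<mapsto> (1728 D, B\<^sup>2, A\<^sup>3)\<close> preserves all four properties. The identity
  \<open>A\<^sup>3 = B\<^sup>2 + 1728 D\<close> gives an additive triple. It is coprime because modulo every irreducible
  factor of \<open>D\<close> the form \<open>B\<close> is a unit away from the primes 2, 3 (and 5 or 7), which divide \<open>a\<close>.
  Since \<open>D\<close> has high multiplicities, its radical divides \<open>a b c r\<close> with \<open>r\<close> the product of the
  distinct remaining factors of \<open>D\<close>, so \<open>rad (a' b' c') \<le> rad (a b c) r A B < c r A B \<le> A\<^sup>3\<close>; the last
  inequality \<open>c r B \<le> A\<^sup>2\<close> holds for \<open>b / a\<close> beyond a rational number slightly below \<open>\<delta>\<^sub>T\<close>, as is seen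
  from the signs of Taylor coefficients there. Finally \<open>f\<^sub>T > 0\<close> beyond its largest zero \<open>\<delta>\<^sub>T\<close>, which says
  that \<open>b' / a' > b / a\<close>.
\<close>

subsection \<open>Binary forms as coefficient lists\<close>

text \<open>The list \<open>[c\<^sub>0, \<dots>, c\<^sub>n]\<close> stands for the form \<open>c\<^sub>0 b\<^sup>n + c\<^sub>1 s b\<^sup>n\<^sup>-\<^sup>1 + \<dots> + c\<^sub>n s\<^sup>n\<close>.\<close>

fun form :: "int list \<Rightarrow> 'a::comm_ring_1 \<Rightarrow> 'a \<Rightarrow> 'a" where
  "form [] s b = 0"
| "form (c # cs) s b = of_int c * b ^ length cs + s * form cs s b"

text \<open>Lists are aligned at the pure power of \<open>b\<close>, so a shorter one counts as its
  form times a power of \<open>b\<close>. Zeros are never trimmed, because the length carries the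
  degree.\<close>

fun fadd :: "int list \<Rightarrow> int list \<Rightarrow> int list" where
  "fadd [] ys = ys"
| "fadd (x # xs) [] = x # xs"
| "fadd (x # xs) (y # ys) = (x + y) # fadd xs ys"

fun fmul :: "int list \<Rightarrow> int list \<Rightarrow> int list" where
  "fmul [] ys = replicate (length ys - 1) 0"
| "fmul (x # xs) ys = fadd (map ((*) x) ys) (0 # fmul xs ys)"

lemma of_int_form: "of_int (form cs s b) = form cs (of_int s) (of_int b)"
  by (induction cs) auto

lemma form_map_mult: "form (map ((*) k) cs) s b = of_int k * form cs s b"
  by (induction cs) (auto simp: algebra_simps)

lemma form_replicate_0_append: "form (replicate n 0 @ cs) s b = s ^ n * form cs s b"
  by (induction n) auto

lemma form_scale: "cs \<noteq> [] \<Longrightarrow> form cs (k * s) (k * b) = k ^ (length cs - 1) * form cs s b"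
proof (induction cs)
  case (Cons c cs)
  then show ?case by (cases cs) (auto simp: algebra_simps power_mult_distrib)
qed simp

lemma length_fadd [simp]: "length (fadd xs ys) = max (length xs) (length ys)"
  by (induction xs ys rule: fadd.induct) auto

lemma form_fadd:
  "form (fadd xs ys) s b
     = b ^ (length ys - length xs) * form xs s b + b ^ (length xs - length ys) * form ys s b"
proof (induction xs ys rule: fadd.induct)
  case (3 x xs y ys)
  have "b ^ max (length xs) (length ys) = b ^ (length ys - length xs) * b ^ length xs"
    "b ^ max (length xs) (length ys) = b ^ (length xs - length ys) * b ^ length ys"
    by (auto simp flip: power_add simp: max_def)
  then show ?case
    using 3 by (simp add: algebra_simps)
qed auto

lemma length_fmul [simp]: "ys \<noteq> [] \<Longrightarrow> length (fmul xs ys) = length xs + length ys - 1"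
proof (induction xs)
  case (Cons x xs)
  then show ?case by (cases ys) auto
qed auto

lemma fmul_eq_Nil [simp]: "ys \<noteq> [] \<Longrightarrow> fmul xs ys = [] \<longleftrightarrow> xs = [] \<and> length ys = 1"
  by (subst length_0_conv [symmetric]) (cases xs; cases ys; auto)

lemma form_fmul: "ys \<noteq> [] \<Longrightarrow> form (fmul xs ys) s b = form xs s b * form ys s b"
proof (induction xs)
  case Nil
  then show ?case
    using form_replicate_0_append [of "length ys - 1" "[]" s b] by simp
next
  case (Cons x xs)
  then show ?case
    by (simp add: form_fadd form_map_mult algebra_simps Suc_diff_le)
qed

fun fprod :: "int list list \<Rightarrow> int list" where
  "fprod [] = [1]"
| "fprod (g # gs) = fmul g (fprod gs)"

lemma fprod_ne: "[] \<notin> set gs \<Longrightarrow> fprod gs \<noteq> []"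
  by (induction gs) auto

lemma form_fprod: "[] \<notin> set gs \<Longrightarrow> form (fprod gs) s b = (\<Prod>g\<leftarrow>gs. form g s b)"
  by (induction gs) (auto simp: form_fmul fprod_ne)

text \<open>\<open>fshift p q\<close> substitutes \<open>(q s, t + p s)\<close> for \<open>(s, b)\<close>, a Taylor shift to the slope \<open>b / s = p / q\<close>.\<close>

fun fshift_row :: "int \<Rightarrow> int \<Rightarrow> int list \<Rightarrow> int \<Rightarrow> int list" where
  "fshift_row p y [] e = [p * y + e]"
| "fshift_row p y (x # xs) e = (x + p * y) # fshift_row p x xs e"

fun fshift_aux :: "int \<Rightarrow> int \<Rightarrow> int \<Rightarrow> int list \<Rightarrow> int list \<Rightarrow> int list" where
  "fshift_aux p q w acc [] = acc"
| "fshift_aux p q w (y # ys) (c # cs) = fshift_aux p q (w * q) (y # fshift_row p y ys (c * w)) cs"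

fun fshift :: "int \<Rightarrow> int \<Rightarrow> int list \<Rightarrow> int list" where
  "fshift p q [] = []"
| "fshift p q (c # cs) = fshift_aux p q q [c] cs"

lemma length_fshift_row [simp]: "length (fshift_row p y xs e) = Suc (length xs)"
  by (induction p y xs e rule: fshift_row.induct) auto

text \<open>This is one Horner step of the shift: multiply the accumulated form by
  \<open>t + p s\<close> and bring in a new pure power of \<open>s\<close>.\<close>

lemma form_fshift_row:
  "form (y # fshift_row p y xs e) s t
     = (t + of_int p * s) * form (y # xs) s t + of_int e * s ^ Suc (length xs)"
proof (induction p y xs e rule: fshift_row.induct)
  case (2 p y x xs e)
  have "form (y # fshift_row p y (x # xs) e) s t
      = of_int y * t ^ Suc (Suc (length xs)) + of_int (p * y) * s * t ^ Suc (length xs)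
        + s * form (x # fshift_row p x xs e) s t"
    by (simp add: algebra_simps)
  also have "\<dots> = (t + of_int p * s) * form (y # x # xs) s t
      + of_int e * s ^ Suc (length (x # xs))"
    unfolding 2 by (simp add: algebra_simps)
  finally show ?case .
qed (simp add: algebra_simps)

text \<open>Horner invariant: \<open>acc\<close> is what the consumed coefficients have become, and
  the last summand is what \<open>cs\<close> still contributes. In the call from
  \<open>fshift\<close>, \<open>w\<close> is always \<open>q ^ length acc\<close>.\<close>

lemma form_fshift_aux:
  assumes "acc \<noteq> []"
  shows "form (fshift_aux p q w acc cs) s t
     = (t + of_int p * s) ^ length cs * form acc s t
       + of_int w * s ^ length acc * form cs (of_int q * s) (t + of_int p * s)"
  using assms
proof (induction p q w acc cs rule: fshift_aux.induct)
  case (2 p q w y ys c cs)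
  let ?b = "t + of_int p * s"
  have "form (fshift_aux p q w (y # ys) (c # cs)) s t
      = ?b ^ length cs * form (y # fshift_row p y ys (c * w)) s t
        + of_int (w * q) * s ^ Suc (length (y # ys)) * form cs (of_int q * s) ?b"
    using 2 by simp
  also have "\<dots> = ?b ^ length (c # cs) * form (y # ys) s t
       + of_int w * s ^ length (y # ys) * form (c # cs) (of_int q * s) ?b"
    unfolding form_fshift_row by (simp add: algebra_simps del: form.simps) (simp add: algebra_simps)
  finally show ?case .
qed auto

lemma form_fshift: "form (fshift p q cs) s t = form cs (of_int q * s) (t + of_int p * s)"
  by (cases cs) (auto simp: form_fshift_aux algebra_simps)

lemma fshift_aux_hd: "acc \<noteq> [] \<Longrightarrow> fshift_aux p q w acc cs \<noteq> [] \<and> hd (fshift_aux p q w acc cs) = hd acc"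
  by (induction p q w acc cs rule: fshift_aux.induct) auto

lemma fshift_ne_hd: "cs \<noteq> [] \<Longrightarrow> fshift p q cs \<noteq> [] \<and> hd (fshift p q cs) = hd cs"
  by (cases cs) (auto simp: fshift_aux_hd)

section \<open>Sign criteria from Taylor coefficients\<close>

lemma form_nonneg:
  fixes s t :: real
  shows "list_all ((\<le>) 0) cs \<Longrightarrow> s \<ge> 0 \<Longrightarrow> t \<ge> 0 \<Longrightarrow> form cs s t \<ge> 0"
  by (induction cs) auto

text \<open>The pair is the slope \<open>p / q\<close>. Nonnegative Taylor coefficients there are an
  executable sufficient condition for the sign on all larger slopes.\<close>

definition nonneg_beyond :: "int \<times> int \<Rightarrow> int list \<Rightarrow> bool" where
  "nonneg_beyond \<rho> cs \<longleftrightarrow> list_all ((\<le>) 0) (fshift (fst \<rho>) (snd \<rho>) cs)"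

definition pos_beyond :: "int \<times> int \<Rightarrow> int list \<Rightarrow> bool" where
  "pos_beyond \<rho> cs \<longleftrightarrow> cs \<noteq> [] \<and> hd cs > 0 \<and> nonneg_beyond \<rho> cs"

lemma nonneg_beyondD:
  fixes s b :: real
  assumes "nonneg_beyond (p, q) cs" "q > 0" "s \<ge> 0" "of_int q * b \<ge> of_int p * s"
  shows "form cs s b \<ge> 0"
proof -
  \<comment> \<open>At \<open>(s / q, ?t)\<close> the shifted form takes exactly the value of
    \<open>cs\<close> at \<open>(s, b)\<close>.\<close>
  let ?t = "b - of_int p * (s / of_int q)"
  have "?t \<ge> 0" using assms by (simp add: field_simps)
  then have "form (fshift p q cs) (s / of_int q) ?t \<ge> 0"
    using assms by (intro form_nonneg) (auto simp: nonneg_beyond_def)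
  then show ?thesis using assms(2) by (simp add: form_fshift)
qed

text \<open>The shift keeps the coefficient of the highest power of \<open>t\<close>, so
  \<open>hd cs > 0\<close> gives strict positivity as soon as \<open>t > 0\<close>.\<close>

lemma pos_beyondD:
  fixes s b :: real
  assumes "pos_beyond (p, q) cs" "q > 0" "s \<ge> 0" "of_int q * b > of_int p * s"
  shows "form cs s b > 0"
proof -
  let ?t = "b - of_int p * (s / of_int q)"
  have "?t > 0" using assms by (simp add: field_simps)
  moreover obtain d ds where ds: "fshift p q cs = d # ds" "d > 0" "list_all ((\<le>) 0) ds"
    using assms(1) fshift_ne_hd [of cs p q]
    by (cases "fshift p q cs") (auto simp: pos_beyond_def nonneg_beyond_def)
  ultimately have "form (fshift p q cs) (s / of_int q) ?t > 0"
    using assms form_nonneg [of ds "s / of_int q" ?t] by (auto intro!: add_pos_nonneg)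
  then show ?thesis using assms(2) by (simp add: form_fshift)
qed

section \<open>Reduction modulo a monic form\<close>

function frem :: "int list \<Rightarrow> int list \<Rightarrow> int list" where
  "frem g [] = []"
| "frem g (c # cs) =
     (if length g \<le> length cs then frem g (fadd cs (map ((*) (- c)) g)) else c # cs)"
  by pat_completeness auto
termination
  by (relation "measure (\<lambda>(g, cs). length cs)") auto

text \<open>Division by the form with coefficient list \<open>1 # g\<close>; dropping a cancelled leading coefficient
  leaves a factor \<open>s\<close>.\<close>

lemma form_frem: "\<exists>k. (form (1 # g) s b :: int) dvd form cs s b - s ^ k * form (frem g cs) s b"
proof (induction g cs rule: frem.induct)
  case (2 g c cs)
  show ?case
  proof (cases "length g \<le> length cs")
    case True
    let ?cs = "fadd cs (map ((*) (- c)) g)"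
    obtain k where "form (1 # g) s b dvd form ?cs s b - s ^ k * form (frem g ?cs) s b"
      using 2 True by blast
    \<comment> \<open>The first summand is the multiple of the divisor removed in this division
      step; the second is \<open>s\<close> times the induction hypothesis.\<close>
    then have "form (1 # g) s b dvd c * b ^ (length cs - length g) * form (1 # g) s b
        + s * (form ?cs s b - s ^ k * form (frem g ?cs) s b)"
      by (intro dvd_add dvd_mult) auto
    also have "c * b ^ (length cs - length g) * form (1 # g) s b
        + s * (form ?cs s b - s ^ k * form (frem g ?cs) s b)
        = form (c # cs) s b - s ^ Suc k * form (frem g (c # cs)) s b"
    proof -
      have "b ^ (length cs - length g) * b ^ length g = b ^ length cs"
        using True by (simp flip: power_add)
      then have "c * b ^ (length cs - length g) * form (1 # g) s b
          = c * b ^ length cs + c * b ^ (length cs - length g) * s * form g s b"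
        by (simp add: algebra_simps)
      then show ?thesis
        using True form_map_mult [of "- c" g s b] by (simp add: form_fadd algebra_simps)
    qed
    finally show ?thesis by blast
  next
    case False
    then show ?thesis by (intro exI [of _ 0]) simp
  qed
qed simp

section \<open>Forms as polynomials in the second variable, and their growth\<close>

lemma form_eq_poly:
  fixes s :: "'a::comm_ring_1"
  shows "\<exists>P. \<forall>x. form cs s x = poly P x"
proof (induction cs)
  case Nil
  show ?case by (intro exI [of _ 0]) simp
next
  case (Cons c cs)
  then obtain P where "\<forall>x. form cs s x = poly P x" by blast
  then show ?case
    by (intro exI [of _ "monom (of_int c) (length cs) + smult s P"]) (simp add: poly_monom)
qed

text \<open>The exponent \<open>length cs\<close> is one more than the degree.\<close>

lemma form_div_power_tendsto_0:
  fixes s :: real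
  shows "((\<lambda>x. form cs s x / x ^ length cs) \<longlongrightarrow> 0) at_top"
proof (induction cs)
  case (Cons c cs)
  have "((\<lambda>x. (of_int c + s * (form cs s x / x ^ length cs)) * inverse x) \<longlongrightarrow> (of_int c + s * 0) * 0) at_top"
    by (intro tendsto_intros Cons tendsto_inverse_0_at_top filterlim_ident)
  moreover have "\<forall>\<^sub>F x in at_top. (of_int c + s * (form cs s x / x ^ length cs)) * inverse x
      = form (c # cs) s x / x ^ length (c # cs)"
    using eventually_gt_at_top [of 0] by eventually_elim (simp add: field_simps)
  ultimately show ?case by (simp add: tendsto_cong)
qed simp

lemma form_div_power_tendsto_hd:
  fixes s :: real
  assumes "cs \<noteq> []"
  shows "((\<lambda>x. form cs s x / x ^ (length cs - 1)) \<longlongrightarrow> of_int (hd cs)) at_top"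
proof -
  obtain c ds where cs: "cs = c # ds" using assms by (cases cs) auto
  have "((\<lambda>x. of_int c + s * (form ds s x / x ^ length ds)) \<longlongrightarrow> of_int c + s * 0) at_top"
    by (intro tendsto_intros form_div_power_tendsto_0)
  moreover have "\<forall>\<^sub>F x in at_top. of_int c + s * (form ds s x / x ^ length ds)
      = form cs s x / x ^ (length cs - 1)"
    using eventually_gt_at_top [of 0] by eventually_elim (simp add: field_simps cs)
  ultimately show ?thesis by (simp add: tendsto_cong cs)
qed

lemma prod_form_div_power_tendsto_1:
  fixes s :: real
  assumes "\<And>g e. (g, e) \<in> set fs \<Longrightarrow> g \<noteq> [] \<and> hd g = 1"
  shows "((\<lambda>x. (\<Prod>(g, e)\<leftarrow>fs. form g s x ^ e) / x ^ (\<Sum>(g, e)\<leftarrow>fs. (length g - 1) * e)) \<longlongrightarrow> 1) at_top"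
  using assms
proof (induction fs)
  case (Cons f fs)
  obtain g e where f: "f = (g, e)" by fastforce
  have "((\<lambda>x. (form g s x / x ^ (length g - 1)) ^ e *
      ((\<Prod>(g, e)\<leftarrow>fs. form g s x ^ e) / x ^ (\<Sum>(g, e)\<leftarrow>fs. (length g - 1) * e)))
    \<longlongrightarrow> of_int (hd g) ^ e * 1) at_top"
    using Cons f by (intro tendsto_intros form_div_power_tendsto_hd) auto
  then show ?case
    using Cons.prems [of g e] f by (simp add: power_divide power_add power_mult)
qed simp

subsection \<open>The data of the twelve families\<close>

text \<open>Writing \<open>a = kap T * s\<close> clears the denominators for \<^const>\<open>C10\<close>.\<close>

fun kap :: "torsion \<Rightarrow> int" where
  "kap C10 = 2"
| "kap T = 1"

text \<open>The product of the primes that are assumed to divide \<open>a\<close>.\<close>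

fun modulus :: "torsion \<Rightarrow> int" where
  "modulus C7 = 42"
| "modulus C10 = 30"
| "modulus T = 6"

text \<open>Rational lower approximations \<open>p / q\<close> of \<open>kap T * delta_T T\<close>.\<close>

fun slope :: "torsion \<Rightarrow> int \<times> int" where
  "slope C3 = (43, 1)"
| "slope C4 = (13, 1)"
| "slope C6 = (43, 1)"
| "slope C7 = (7, 1)"
| "slope C8 = (22, 9)"
| "slope C9 = (9, 2)"
| "slope C10 = (6, 1)"
| "slope C12 = (31, 8)"
| "slope C2xC2 = (1728, 1)"
| "slope C2xC4 = (12, 1)"
| "slope C2xC6 = (6, 1)"
| "slope C2xC8 = (3, 1)"

fun A_form :: "torsion \<Rightarrow> int list" where
  "A_form C3 =
     fmul [-1, -6, -3, 1] (fmul [-1, 0, 3, 1] [1, -6, 24, 88, 69, 12, 1])"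
| "A_form C4 =
     fmul [1, -2, 0, -2, 1] [1, -6, 12, -14, 243, -468, 456, -468, 243, -14, 12, -6, 1]"
| "A_form C6 =
     fmul [1, 4, -6, 4, 1] [1, -12, 78, -188, 111, 264, -444, 264, 111, -188, 78, -12, 1]"
| "A_form C7 =
     fmul [1, 1, 1] [1, -5, -10, 15, 30, 11, 1]"
| "A_form C8 =
     [1, 0, -8, 0, 12, 0, 8, 0, -10, 0, 8, 0, 12, 0, -8, 0, 1]"
| "A_form C9 =
     fmul [-1, 0, 3, 1] [-1, 0, 9, 27, 45, 54, 48, 27, 9, 1]"
| "A_form C10 =
     [1, 8, 16, -40, -240, -192, 1664, 6528, 11520, 11520, 6656, 2048, 256]"
| "A_form C12 =
     fmul [1, -2, 0, -2, 1] [1, -6, 12, -14, 3, 12, -24, 12, 3, -14, 12, -6, 1]"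
| "A_form C2xC2 =
     [1, 0, 232, 0, 732, 0, -1192, 0, 710, 0, -1192, 0, 732, 0, 232, 0, 1]"
| "A_form C2xC4 =
     fmul [1, 4, 4, -28, 6, 28, 4, -4, 1] [1, -4, 4, 28, 6, -28, 4, 4, 1]"
| "A_form C2xC6 =
     fmul [1, -2, 6, -2, 1] [1, -6, 6, 10, 15, -36, 84, -36, 15, 10, 6, -6, 1]"
| "A_form C2xC8 =
     [1, 0, -8, 0, 12, 0, 8, 0, 230, 0, 8, 0, 12, 0, -8, 0, 1]"

text \<open>Note the sign: these are the forms \<open>- B_T\<close>, which are positive beyond the slope.\<close>

fun B_form :: "torsion \<Rightarrow> int list" where
  "B_form C3 =
     fmul [1, -6, -30, -20, 15, 12, 1] [1, 6, 48, -58, -288, 720, 3030, 3636, 1899, 428, 48, 6,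
       1]"
| "B_form C4 =
     fmul [1, -4, 28, -52, 46, -52, 28, -4, 1] [1, -8, 0, 104, -220, 216, -728, 1144, -1026,
       1144, -728, 216, -220, 104, 0, -8, 1]"
| "B_form C6 =
     fmul [1, -4, 4, 20, -26, 20, 4, -4, 1] [1, -8, 24, -568, 2684, -4776, 2344, 4840, -8826,
       4840, 2344, -4776, 2684, -568, 24, -8, 1]"
| "B_form C7 =
     [1, -6, -15, 46, 174, 222, 273, 486, 570, 354, 117, 18, 1]"
| "B_form C8 =
     fmul [1, 0, -4, 0, -2, 0, -4, 0, 1] [1, 0, -8, 0, 12, 0, 8, 0, -34, 0, 8, 0, 12, 0, -8, 0,
       1]"
| "B_form C9 =
     [1, 0, -18, -42, 27, 306, 735, 1080, 1359, 2032, 3240, 4230, 4128, 2970, 1557, 570, 135,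
       18, 1]"
| "B_form C10 =
     fmul [1, 2, 2] (fmul [-1, -2, 6, 12, 4] (fmul [1, 8, 24, 24, 8] [-1, 0, 8, 0, 56, 320, 512,
       320, 64]))"
| "B_form C12 =
     fmul [1, -4, 4, -4, -2, -4, 4, -4, 1] [1, -8, 24, -40, 44, -24, -32, 88, -114, 88, -32,
       -24, 44, -40, 24, -8, 1]"
| "B_form C2xC2 =
     fmul [1, 0, 20, 0, -26, 0, 20, 0, 1] (fmul [1, 24, 20, 24, -26, -24, 20, -24, 1] [1, -24,
       20, -24, -26, 24, 20, 24, 1])"
| "B_form C2xC4 =
     fmul [1, 4, -6, -4, 1] (fmul [1, -4, -6, 4, 1] (fmul [1, 0, -4, 0, 22, 0, -4, 0, 1] [1, 0,
       20, 0, -26, 0, 20, 0, 1]))"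
| "B_form C2xC6 =
     fmul [1, -4, 4, -28, 22, -28, 4, -4, 1] (fmul [1, -4, 4, -4, -2, -4, 4, -4, 1] [1, -4, 4,
       20, -26, 20, 4, -4, 1])"
| "B_form C2xC8 =
     fmul [1, 0, -4, 0, -26, 0, -4, 0, 1] (fmul [1, 0, -4, 0, -2, 0, -4, 0, 1] [1, 0, -4, 0, 22,
       0, -4, 0, 1])"

text \<open>\<open>D = s ^ a_mult T * \<Prod> g ^ e\<close>, where the signs of the \<open>g\<close> are chosen to be positive beyond the slope; the
  first two factors are always \<open>b\<close> and \<open>a + b\<close>.\<close>

fun a_mult :: "torsion \<Rightarrow> nat" where
  "a_mult C3 = 3"
| "a_mult C4 = 4"
| "a_mult C6 = 3"
| "a_mult C7 = 7"
| "a_mult C8 = 16"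
| "a_mult C9 = 9"
| "a_mult C10 = 5"
| "a_mult C12 = 12"
| "a_mult C2xC2 = 2"
| "a_mult C2xC4 = 4"
| "a_mult C2xC6 = 6"
| "a_mult C2xC8 = 8"

fun D_factors :: "torsion \<Rightarrow> (int list \<times> nat) list" where
  "D_factors C3 =
     [([1, 0], 3), ([1, 1], 3), ([1, 1, 1], 9), ([1, -3, -6, -1], 3)]"
| "D_factors C4 =
     [([1, 0], 4), ([1, 1], 6), ([1, -1], 2), ([1, 0, 1], 1), ([1, -4, 1], 3), ([1, -1, 1], 12)]"
| "D_factors C6 =
     [([1, 0], 3), ([1, 1], 2), ([1, -1], 6), ([1, -1, 1], 1), ([1, -4, 1], 4), ([1, 0, 1], 12)]"
| "D_factors C7 =
     [([1, 0], 7), ([1, 1], 7), ([1, -5, -8, -1], 1)]"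
| "D_factors C8 =
     [([1, 0], 16), ([1, 1], 4), ([1, -1], 4), ([1, 2, -1], 1), ([1, -2, -1], 1), ([1, 0, 1], 2)]"
| "D_factors C9 =
     [([1, 0], 9), ([1, 1], 9), ([1, 1, 1], 3), ([1, -3, -6, -1], 1)]"
| "D_factors C10 =
     [([1, 0], 10), ([1, 2], 10), ([1, 1], 5), ([1, 3, 1], 1), ([1, -2, -4], 2)]"
| "D_factors C12 =
     [([1, 0], 12), ([1, 1], 2), ([1, -1], 6), ([1, -4, 1], 1), ([1, 0, 1], 3), ([1, -1, 1], 4)]"
| "D_factors C2xC2 =
     [([1, 0], 2), ([1, 1], 2), ([1, -1], 2), ([1, 0, 1], 4), ([1, 2, -1], 8), ([1, -2, -1], 8)]"
| "D_factors C2xC4 =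
     [([1, 0], 4), ([1, 1], 4), ([1, -1], 4), ([1, 2, -1], 4), ([1, -2, -1], 4), ([1, 0, 1], 8)]"
| "D_factors C2xC6 =
     [([1, 0], 6), ([1, 1], 4), ([1, -1], 12), ([1, -4, 1], 2), ([1, -1, 1], 2), ([1, 0, 1], 6)]"
| "D_factors C2xC8 =
     [([1, 0], 8), ([1, 1], 8), ([1, -1], 8), ([1, 2, -1], 2), ([1, -2, -1], 2), ([1, 0, 1], 4)]"

text \<open>For each factor \<open>g\<close> of \<open>D\<close> a form \<open>u\<close> such that \<open>u B\<close> is congruent to \<open>R s\<^sup>N\<close> modulo \<open>g\<close>, where \<open>R\<close> has only
  prime divisors of \<open>modulus T\<close>; found by the extended Euclidean algorithm.\<close>

fun B_inverses :: "torsion \<Rightarrow> int list list" where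
  "B_inverses C3 = [[1], [1], [1], [-17499, 55347, 96388]]"
| "B_inverses C4 = [[1], [1], [1], [1], [2107560, -7865521], [1]]"
| "B_inverses C6 = [[1], [1], [1], [1], [2107560, -7865521], [1]]"
| "B_inverses C7 = [[1], [1], [-663, 3289, 5573]]"
| "B_inverses C8 = [[1], [1], [1], [-13860, -33461], [13860, -33461], [1]]"
| "B_inverses C9 = [[1], [1], [1], [-17499, 55347, 96388]]"
| "B_inverses C10 = [[1], [1], [1], [-76, -199], [219602, -710647]]"
| "B_inverses C12 = [[1], [1], [1], [2107560, -7865521], [1], [1]]"
| "B_inverses C2xC2 = [[1], [1], [1], [1], [-13860, -33461], [13860, -33461]]"
| "B_inverses C2xC4 = [[1], [1], [1], [-13860, -33461], [13860, -33461], [1]]"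
| "B_inverses C2xC6 = [[1], [1], [1], [2107560, -7865521], [1], [1]]"
| "B_inverses C2xC8 = [[1], [1], [1], [-13860, -33461], [13860, -33461], [1]]"

text \<open>The dropped factors are \<open>b\<close> and \<open>a + b = c\<close>, whose primes
  already occur in \<open>a b c\<close>.\<close>

definition R_form :: "torsion \<Rightarrow> int list" where
  "R_form T = fprod (map fst (drop 2 (D_factors T)))"

text \<open>This encodes \<open>A^2 - c R B\<close>, where \<open>[1, kap T]\<close> is
  \<open>c = b + kap T * s\<close>; its nonnegativity is the size estimate.\<close>

definition H_form :: "torsion \<Rightarrow> int list" where
  "H_form T = fadd (fmul (A_form T) (A_form T))
                   (map ((*) (- 1)) (fmul [1, kap T] (fmul (R_form T) (B_form T))))"

text \<open>Degree count: \<open>c R B\<close> matches \<open>A^2\<close>, and \<open>A^3\<close>,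
  \<open>B^2\<close> and \<open>D\<close> share one degree.\<close>

lemma length_forms:
  "A_form T \<noteq> []" "B_form T \<noteq> []" "R_form T \<noteq> []"
  "length (R_form T) + length (B_form T) + 1 = 2 * length (A_form T)"
  "3 * length (A_form T) = 2 * length (B_form T) + 1"
  "a_mult T \<ge> 2"
  "a_mult T + (\<Sum>(g, e)\<leftarrow>D_factors T. (length g - 1) * e) + 2 = 2 * length (B_form T)"
  by (induction T; code_simp)+

lemma slope_pos: "fst (slope T) > 0" "snd (slope T) > 0"
  by (induction T; code_simp)+

lemma D_factors_ne: "[] \<notin> fst ` set (D_factors T)"
  by (induction T; simp)

lemma pos_beyond_D_factors: "list_all (\<lambda>(g, e). pos_beyond (slope T) g) (D_factors T)"
  by (induction T; code_simp)

lemma pos_beyond_B_form: "pos_beyond (slope T) (B_form T)"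
  by (induction T; code_simp)

lemma nonneg_beyond_H_form: "nonneg_beyond (slope T) (H_form T)"
  by (induction T; code_simp)

text \<open>With denominators cleared, the numerator of \<open>f_T\<close> is negative at
  \<open>p / (kap T * q)\<close>; this forces a zero beyond that point.\<close>

lemma slope_below_delta:
  "case slope T of (p, q) \<Rightarrow>
     kap T * q * form (B_form T) q p ^ 2
       < 1728 * p * (q ^ a_mult T * (\<Prod>(g, e)\<leftarrow>D_factors T. form g q p ^ e))"
  by (induction T; code_simp)

lemma D_factors_monic: "list_all (\<lambda>(g, e). hd g = 1) (D_factors T)"
  by (induction T; code_simp)

lemma D_factors_take_2: "map fst (take 2 (D_factors T)) = [[1, 0], [1, kap T]]"
  by (induction T; code_simp)

text \<open>The divisibility has content for \<open>C10\<close>: there 2 may divide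
  \<open>a = 2 s\<close> without dividing \<open>s\<close>, and modulo 2 the form is still a power
  of \<open>b\<close>.\<close>

lemma B_form_kap: "hd (B_form T) = 1 \<and> list_all (\<lambda>c. kap T dvd c) (tl (B_form T))"
  by (induction T; code_simp)

text \<open>A coprimality certificate in place of a resultant: a common prime of \<open>g\<close>
  and \<open>B\<close> divides the remainder of \<open>u B\<close>, which is a constant times a
  power of \<open>s\<close>. The exponent 24 serves all families at once.\<close>

lemma D_factors_resultant:
  "list_all (\<lambda>((g, e), u).
       (let r = frem (tl g) (fmul u (B_form T))
        in r \<noteq> [] \<and> list_all ((=) 0) (butlast r) \<and> last r dvd modulus T ^ 24))
     (zip (D_factors T) (B_inverses T))"
  by (induction T; code_simp)

lemma length_B_inverses: "length (B_inverses T) = length (D_factors T)"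
  by (induction T; code_simp)

section \<open>The polynomials in terms of their coefficient lists\<close>

lemma A_poly_eq_form: "A_poly T (of_int (kap T) * s) b = form (A_form T) s b"
  by (induction T; simp add: form_fmul; algebra)

lemma B_poly_eq_form: "B_poly T (of_int (kap T) * s) b = - form (B_form T) s b"
  by (induction T; simp add: form_fmul; algebra)

lemma D_poly_eq_prod:
  "D_poly T (of_int (kap T) * s) b = s ^ a_mult T * (\<Prod>(g, e)\<leftarrow>D_factors T. form g s b ^ e)"
  by (induction T; simp del: mult_cancel_left mult_cancel_right; algebra)

text \<open>It has the shape of the relation \<open>c4^3 = c6^2 + 1728 Delta\<close> between the
  invariants of an elliptic curve.\<close>

lemma A_poly_cubed: "A_poly T a b ^ 3 = (B_poly T a b)\<^sup>2 + 1728 * D_poly T a b"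
  by (induction T; simp only: A_poly.simps B_poly.simps D_poly.simps; algebra)

subsection \<open>Positivity of \<open>f\<^sub>T\<close> beyond \<open>\<delta>\<^sub>T\<close>\<close>

lemma kap_pos: "kap T > 0"
  by (induction T) auto

lemma poly_eq_form_div:
  "A_poly T a b = form (A_form T) (a / of_int (kap T)) b"
  "B_poly T a b = - form (B_form T) (a / of_int (kap T)) b"
  "D_poly T a b = (a / of_int (kap T)) ^ a_mult T
     * (\<Prod>(g, e)\<leftarrow>D_factors T. form g (a / of_int (kap T)) b ^ e)"
  using kap_pos [of T] A_poly_eq_form [of T "a / of_int (kap T)" b]
    B_poly_eq_form [of T "a / of_int (kap T)" b] D_poly_eq_prod [of T "a / of_int (kap T)" b]
  by simp_all

lemma A_poly_scale: "A_poly T (k * a) (k * b) = k ^ (length (A_form T) - 1) * A_poly T a b"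
  using form_scale [of "A_form T" k "a / of_int (kap T)" b] length_forms
  by (simp add: poly_eq_form_div)

lemma B_poly_scale: "B_poly T (k * a) (k * b) = k ^ (length (B_form T) - 1) * B_poly T a b"
  using form_scale [of "B_form T" k "a / of_int (kap T)" b] length_forms
  by (simp add: poly_eq_form_div)

text \<open>By \<open>A_poly_cubed\<close>, \<open>1728 D\<close> is the difference of
  \<open>A^3\<close> and \<open>B^2\<close>, homogeneous of the same degree.\<close>

lemma D_poly_scale: "D_poly T (k * a) (k * b) = k ^ (2 * (length (B_form T) - 1)) * D_poly T a b"
proof -
  have "3 * (length (A_form T) - 1) = 2 * (length (B_form T) - 1)"
    using length_forms(5) [of T] by simp
  then have "(k ^ (length (A_form T) - 1)) ^ 3 = k ^ (2 * (length (B_form T) - 1))"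
    "(k ^ (length (B_form T) - 1))\<^sup>2 = k ^ (2 * (length (B_form T) - 1))"
    by (simp_all flip: power_mult add: mult.commute)
  then have "1728 * D_poly T (k * a) (k * b)
      = k ^ (2 * (length (B_form T) - 1)) * (A_poly T a b ^ 3 - (B_poly T a b)\<^sup>2)"
    using A_poly_cubed [of T "k * a" "k * b"]
    unfolding A_poly_scale B_poly_scale power_mult_distrib by (simp add: right_diff_distrib)
  then show ?thesis
    using A_poly_cubed [of T a b] by simp
qed

text \<open>\<open>slope T\<close> concerns \<open>b / s\<close>; division by \<open>kap T\<close>
  gives the bound for \<open>b / a\<close>.\<close>

definition slope_bound :: "torsion \<Rightarrow> real" where
  "slope_bound T = of_int (fst (slope T)) / (of_int (snd (slope T)) * of_int (kap T))"

lemma slope_bound_pos: "slope_bound T > 0"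
  using slope_pos [of T] kap_pos [of T] by (simp add: slope_bound_def)

lemma
  fixes s b :: real
  assumes "s > 0" "b / (of_int (kap T) * s) > slope_bound T"
  shows D_factor_pos: "(g, e) \<in> set (D_factors T) \<Longrightarrow> form g s b > 0"
    and B_form_pos: "form (B_form T) s b > 0"
    and H_form_nonneg: "form (H_form T) s b \<ge> 0"
    and D_poly_pos: "D_poly T (of_int (kap T) * s) b > 0"
proof -
  obtain p q where pq: "slope T = (p, q)" by fastforce
  then have q: "q > 0" using slope_pos(2) [of T] by simp
  have gt: "of_int q * b > of_int p * s"
    using assms q kap_pos [of T] by (simp add: slope_bound_def pq field_simps)
  show D: "form g s b > 0" if "(g, e) \<in> set (D_factors T)" for g e
    using that pos_beyond_D_factors [of T] assms(1) q gt
    by (intro pos_beyondD [of p q]) (auto simp: list_all_iff pq)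
  show "form (B_form T) s b > 0"
    using pos_beyond_B_form [of T] assms(1) q gt by (intro pos_beyondD [of p q]) (auto simp: pq)
  show "form (H_form T) s b \<ge> 0"
    using nonneg_beyond_H_form [of T] assms(1) q gt
    by (intro nonneg_beyondD [of p q]) (auto simp: pq)
  have "(\<Prod>(g, e)\<leftarrow>fs. form g s b ^ e) > 0" if "set fs \<subseteq> set (D_factors T)" for fs
    using that D by (induction fs) auto
  then show "D_poly T (of_int (kap T) * s) b > 0"
    using assms(1) by (simp add: D_poly_eq_prod)
qed

lemma poly_eq_B: "\<exists>P. \<forall>x. B_poly T 1 x = poly P x"
proof -
  obtain P :: "real poly" where "\<And>x. form (B_form T) (1 / of_int (kap T)) x = poly P x"
    using form_eq_poly by blast
  then show ?thesis by (intro exI [of _ "- P"]) (simp add: poly_eq_form_div)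
qed

lemma poly_eq_D: "\<exists>P. \<forall>x. D_poly T 1 x = poly P x"
proof -
  obtain P :: "real poly" where P: "\<And>x. form (A_form T) (1 / of_int (kap T)) x = poly P x"
    using form_eq_poly by blast
  obtain Q where Q: "\<And>x. B_poly T 1 x = poly Q x" using poly_eq_B by blast
  have "D_poly T 1 x = poly (smult (1 / 1728) (P ^ 3 - Q\<^sup>2)) x" for x
    using A_poly_cubed [of T 1 x] P Q by (simp add: poly_eq_form_div(1))
  then show ?thesis by blast
qed

text \<open>The square of \<open>B\<close> is monic of degree \<open>2 n\<close> in
  \<open>x\<close>, whereas \<open>x D\<close> has degree \<open>2 n - a_mult T + 1\<close>, which
  is smaller since \<open>a_mult T \<ge> 2\<close>.\<close>

lemma eventually_f_T_numerator_pos: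
  "\<forall>\<^sub>F x in at_top. (B_poly T 1 x)\<^sup>2 - 1728 * x * D_poly T 1 x > 0"
proof -
  define \<sigma> :: real where "\<sigma> = 1 / of_int (kap T)"
  define n where "n = length (B_form T) - 1"
  define i where "i = a_mult T"
  define m where "m = (\<Sum>(g, e)\<leftarrow>D_factors T. (length g - 1) * e)"
  define C where "C = (\<lambda>x. \<Prod>(g, e)\<leftarrow>D_factors T. form g \<sigma> x ^ e)"
  have len: "i + m = 2 * n" "i \<ge> 2"
    using length_forms [of T] by (auto simp: n_def i_def m_def)
  have B: "B_poly T 1 x = - form (B_form T) \<sigma> x" and D: "D_poly T 1 x = \<sigma> ^ i * C x" for x
    by (simp_all add: poly_eq_form_div \<sigma>_def C_def i_def)
  have "((\<lambda>x. C x / x ^ m) \<longlongrightarrow> 1) at_top"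
    unfolding C_def m_def
    using pos_beyond_D_factors [of T] D_factors_monic [of T]
    by (intro prod_form_div_power_tendsto_1) (auto simp: list_all_iff pos_beyond_def)
  moreover have "((\<lambda>x. form (B_form T) \<sigma> x / x ^ n) \<longlongrightarrow> of_int (hd (B_form T))) at_top"
    unfolding n_def by (intro form_div_power_tendsto_hd length_forms)
  moreover have inv: "(inverse \<longlongrightarrow> (0::real)) at_top"
    by (intro tendsto_inverse_0_at_top filterlim_ident)
  ultimately have "((\<lambda>x. (form (B_form T) \<sigma> x / x ^ n)\<^sup>2
        - 1728 * \<sigma> ^ i * inverse x ^ (i - 1) * (C x / x ^ m))
      \<longlongrightarrow> (of_int (hd (B_form T)))\<^sup>2 - 1728 * \<sigma> ^ i * 0 ^ (i - 1) * 1) at_top"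
    by (intro tendsto_intros)
  then have "((\<lambda>x. (form (B_form T) \<sigma> x / x ^ n)\<^sup>2
        - 1728 * \<sigma> ^ i * inverse x ^ (i - 1) * (C x / x ^ m)) \<longlongrightarrow> 1) at_top"
    \<comment> \<open>Here \<open>i \<ge> 2\<close> makes the exponent \<open>i - 1\<close>
      positive, so that \<open>0 ^ (i - 1) = 0\<close>.\<close>
    using len B_form_kap [of T] by (simp add: power_0_left)
  then have "\<forall>\<^sub>F x in at_top. (form (B_form T) \<sigma> x / x ^ n)\<^sup>2
        - 1728 * \<sigma> ^ i * inverse x ^ (i - 1) * (C x / x ^ m) > 0"
    by (rule order_tendstoD) simp
  then show ?thesis
    using eventually_gt_at_top [of 0]
  proof eventually_elim
    case (elim x)
    have "x ^ (2 * n) = x ^ (i - 1) * (x * x ^ m)"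
      using len by (simp flip: power_Suc power_add)
    then have 1: "inverse x ^ (i - 1) * (C x / x ^ m) = x * C x / x ^ (2 * n)"
      using elim by (simp add: field_simps)
    have 2: "1728 * \<sigma> ^ i * inverse x ^ (i - 1) * (C x / x ^ m)
        = 1728 * \<sigma> ^ i * (inverse x ^ (i - 1) * (C x / x ^ m))"
      by (simp only: mult.assoc)
    have 3: "1728 * \<sigma> ^ i * (x * C x / x ^ (2 * n)) = 1728 * x * D_poly T 1 x / x ^ (2 * n)"
      by (simp add: D)
    have 4: "(form (B_form T) \<sigma> x / x ^ n)\<^sup>2 = (B_poly T 1 x)\<^sup>2 / x ^ (2 * n)"
      by (simp add: B power_divide power_mult mult.commute)
    have "((B_poly T 1 x)\<^sup>2 - 1728 * x * D_poly T 1 x) / x ^ (2 * n) > 0"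
      using elim(1) unfolding 2 1 3 4 diff_divide_distrib .
    then show ?case using elim by (simp add: zero_less_divide_iff)
  qed
qed

text \<open>Scaling \<open>(1, slope_bound T)\<close> by \<open>k = kap T * q\<close> gives the
  integral point \<open>(k, p)\<close>, where the exact check \<open>slope_below_delta\<close>
  applies.\<close>

lemma f_T_neg_at_slope_bound:
  "(B_poly T 1 (slope_bound T))\<^sup>2 < 1728 * slope_bound T * D_poly T 1 (slope_bound T)"
proof -
  obtain p q where pq: "slope T = (p, q)" by fastforce
  define k where "k = real_of_int (kap T) * of_int q"
  have q: "q > 0" and k: "k > 0"
    using slope_pos(2) [of T] kap_pos [of T] by (simp_all add: pq k_def)
  have kp: "k * slope_bound T = of_int p"
    using q kap_pos [of T] by (simp add: slope_bound_def pq k_def)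
  have "of_int (kap T * q * form (B_form T) q p ^ 2)
       < (of_int (1728 * p * (q ^ a_mult T * (\<Prod>(g, e)\<leftarrow>D_factors T. form g q p ^ e))) :: real)"
    using slope_below_delta [of T] by (subst of_int_less_iff) (simp add: pq)
  moreover have "of_int (\<Prod>(g, e)\<leftarrow>fs. form g q p ^ e)
      = (\<Prod>(g, e)\<leftarrow>fs. form g (real_of_int q) (real_of_int p) ^ e)" for fs
    by (induction fs) (auto simp: of_int_form)
  ultimately have "k * (B_poly T k (of_int p))\<^sup>2 < 1728 * of_int p * D_poly T k (of_int p)"
    using kap_pos [of T] by (simp add: poly_eq_form_div k_def of_int_form)
  also have "B_poly T k (of_int p) = k ^ (length (B_form T) - 1) * B_poly T 1 (slope_bound T)"
    using B_poly_scale [of T k 1 "slope_bound T"] by (simp add: kp)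
  also have "D_poly T k (of_int p) = k ^ (2 * (length (B_form T) - 1)) * D_poly T 1 (slope_bound T)"
    using D_poly_scale [of T k 1 "slope_bound T"] by (simp add: kp)
  finally have "(k * k ^ (2 * (length (B_form T) - 1))) * (B_poly T 1 (slope_bound T))\<^sup>2
      < (k * k ^ (2 * (length (B_form T) - 1))) * (1728 * slope_bound T * D_poly T 1 (slope_bound T))"
    unfolding kp [symmetric] power_even_eq power_mult_distrib by (simp only: mult_ac)
  then show ?thesis
    using k by (subst (asm) mult_less_cancel_left_pos) simp_all
qed

lemma D_poly_1_pos: "x > slope_bound T \<Longrightarrow> D_poly T 1 x > 0"
  using D_poly_pos [of "1 / of_int (kap T)" T x] kap_pos [of T] by simp

text \<open>The numerator of \<open>f_T\<close> is negative at the slope bound and positive for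
  large \<open>x\<close>, so the intermediate value theorem gives a zero beyond the bound. A
  nonpositive value beyond \<open>delta_T T\<close> would give a further zero, against
  maximality.\<close>

lemma
  shows slope_bound_less_delta_T: "slope_bound T < delta_T T"
    and f_T_pos_beyond_delta_T:
      "\<And>x. x > delta_T T \<Longrightarrow> 1728 * x * D_poly T 1 x < (B_poly T 1 x)\<^sup>2"
proof -
  obtain P where P: "\<And>x. B_poly T 1 x = poly P x" using poly_eq_B [of T] by blast
  obtain Q where Q: "\<And>x. D_poly T 1 x = poly Q x" using poly_eq_D [of T] by blast
  \<comment> \<open>Where \<open>D\<close> does not vanish, \<open>f_T = F / (1728 D)\<close>, so
    \<open>F\<close> has the same zeros there.\<close>
  define F where "F = P\<^sup>2 - smult 1728 ([:0, 1:] * Q)"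
  have F: "poly F x = (B_poly T 1 x)\<^sup>2 - 1728 * x * D_poly T 1 x" for x
    by (simp add: F_def P Q)
  have neg: "poly F (slope_bound T) < 0"
    using f_T_neg_at_slope_bound [of T] by (simp add: F)
  then have "F \<noteq> 0" by auto
  have "Q \<noteq> 0"
    using D_poly_1_pos [of T "slope_bound T + 1"] by (auto simp: Q)
  \<comment> \<open>This makes the set of zeros nonempty, as \<open>Max\<close> requires.\<close>
  have "D_poly T 1 0 = 0"
    by (induction T) auto
  have theta_le: "theta_T T \<le> slope_bound T"
    unfolding theta_T_def
  proof (intro Max.boundedI)
    show "finite {x. D_poly T 1 x = 0}"
      unfolding Q using \<open>Q \<noteq> 0\<close> by (rule poly_roots_finite)
    show "{x. D_poly T 1 x = 0} \<noteq> {}"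
      using \<open>D_poly T 1 0 = 0\<close> by auto
    show "x \<le> slope_bound T" if "x \<in> {x. D_poly T 1 x = 0}" for x
      using that D_poly_1_pos [of T x] by force
  qed
  define S where "S = {x. x \<in> {theta_T T<..} \<and> f_T T x = 0}"
  have D_ne: "D_poly T 1 x \<noteq> 0" if "x > theta_T T" for x
  proof
    assume "D_poly T 1 x = 0"
    then have "x \<le> theta_T T"
      unfolding theta_T_def using poly_roots_finite [OF \<open>Q \<noteq> 0\<close>] by (intro Max_ge) (auto simp: Q)
    with that show False by simp
  qed
  have S_iff: "x \<in> S \<longleftrightarrow> poly F x = 0" if "x > theta_T T" for x
    using that D_ne [OF that] by (simp add: S_def f_T_def F divide_eq_eq mult_ac)
  have "poly F x = 0" if "x \<in> S" for x
  proof -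
    have "x > theta_T T" using that by (simp add: S_def)
    with S_iff that show ?thesis by blast
  qed
  then have "finite S"
    by (intro finite_subset [OF _ poly_roots_finite [OF \<open>F \<noteq> 0\<close>]]) blast
  have zero_beyond: "\<exists>z\<in>S. z \<ge> y \<and> z > slope_bound T"
    if y: "y \<ge> slope_bound T" "poly F y \<le> 0" for y
  proof -
    obtain N where N: "\<And>x. x \<ge> N \<Longrightarrow> poly F x > 0"
      using eventually_f_T_numerator_pos [of T] unfolding eventually_at_top_linorder F [symmetric] by blast
    have "\<exists>z\<ge>y. z \<le> max N y \<and> poly F z = 0"
      using y N [of "max N y"] by (intro IVT) auto
    then obtain z where z: "z \<ge> y" "poly F z = 0" by blast
    \<comment> \<open>Strictness holds because \<open>F\<close> is negative at the bound itself; it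
      puts \<open>z\<close> into the open domain beyond \<open>theta_T T\<close>.\<close>
    moreover have "z > slope_bound T"
      using z y(1) neg by (cases "z = slope_bound T") auto
    ultimately show ?thesis
      using S_iff [of z] theta_le by auto
  qed
  have le_delta: "z \<le> delta_T T" if "z \<in> S" for z
    using that \<open>finite S\<close> unfolding delta_T_def S_def by (intro Max_ge)
  obtain z where "z \<in> S" "z > slope_bound T"
    using zero_beyond [of "slope_bound T"] neg by auto
  then show less: "slope_bound T < delta_T T"
    using le_delta [of z] by simp
  fix x assume x: "x > delta_T T"
  show "1728 * x * D_poly T 1 x < (B_poly T 1 x)\<^sup>2"
  proof (rule ccontr)
    assume "\<not> 1728 * x * D_poly T 1 x < (B_poly T 1 x)\<^sup>2"
    then obtain z where "z \<in> S" "z \<ge> x"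
      using zero_beyond [of x] less x by (auto simp: F)
    with x le_delta [of z] show False by simp
  qed
qed

subsection \<open>The recursion step\<close>

text \<open>The primes of \<open>n\<close> that do not divide \<open>x\<close> all divide
  \<open>y\<close>, so their product is at most \<open>y\<close>.\<close>

lemma rad_le_rad_mult:
  assumes "x \<noteq> 0" "y > 0" "\<And>p. prime p \<Longrightarrow> p dvd n \<Longrightarrow> p dvd x \<or> p dvd y"
  shows "rad n \<le> rad x * y"
proof -
  have ge_1: "p \<ge> 1" if "p \<in> prime_factors k" for p k :: int
    using that prime_gt_0_int [of p] by (auto dest: in_prime_factors_imp_prime)
  have "\<Prod>(prime_factors n) \<le> \<Prod>(prime_factors x \<union> prime_factors y)"
  proof (rule prod_mono2)
    show "prime_factors n \<subseteq> prime_factors x \<union> prime_factors y"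
    proof
      fix p assume "p \<in> prime_factors n"
      then have "prime p" "p dvd n" by (auto simp: in_prime_factors_iff)
      with assms show "p \<in> prime_factors x \<union> prime_factors y"
        using assms(3) [of p] by (auto simp: in_prime_factors_iff)
    qed
  qed (use ge_1 in \<open>force+\<close>)
  also have "\<Prod>(prime_factors x \<union> prime_factors y)
      = \<Prod>(prime_factors x) * \<Prod>(prime_factors y - prime_factors x)"
    by (subst prod.union_disjoint [symmetric]) (auto intro: prod.cong)
  also have "\<Prod>(prime_factors y - prime_factors x) \<le> \<Prod>(prime_factors y)"
    by (rule prod_mono2) (use ge_1 in \<open>force+\<close>)
  also have "\<Prod>(prime_factors y) \<le> (\<Prod>p\<in>prime_factors y. p ^ multiplicity p y)"
  proof (rule prod_mono)
    fix p assume p: "p \<in> prime_factors y"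
    then have "p ^ 1 \<le> p ^ multiplicity p y"
      using ge_1 [OF p] by (intro power_increasing) (auto simp: prime_factors_multiplicity)
    then show "0 \<le> p \<and> p \<le> p ^ multiplicity p y"
      using ge_1 [OF p] by simp
  qed
  also have "\<dots> = y"
    using assms(2) prod_prime_factors [of y] by simp
  finally show ?thesis
    using prod_nonneg [of "prime_factors x" "\<lambda>p. p"] ge_1 by (force simp: rad_def mult_left_mono)
qed

section \<open>Common prime divisors of \<open>B\<close> and the factors of \<open>D\<close>\<close>

lemma form_last:
  "r \<noteq> [] \<Longrightarrow> list_all ((=) 0) (butlast r) \<Longrightarrow> form r s b = s ^ (length r - 1) * of_int (last r)"
proof (induction r)
  case (Cons c r)
  then show ?case by (cases r) auto
qed simp

lemma dvd_form: "list_all (\<lambda>c. k dvd c) cs \<Longrightarrow> k dvd (form cs s b :: int)"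
  by (induction cs) auto

text \<open>If \<open>p\<close> divides \<open>kap T * s\<close>, then modulo \<open>p\<close> the
  form \<open>B\<close> is a power of \<open>b\<close>, against coprimality. If \<open>p\<close>
  also divides a factor of \<open>D\<close>, the certificate makes it divide \<open>s\<close> or
  \<open>modulus T\<close>, hence \<open>kap T * s\<close>, and the first case applies.\<close>

lemma
  fixes p s b :: int
  assumes "prime p" "p dvd form (B_form T) s b" "coprime (kap T * s) b"
  shows not_dvd_if_dvd_B_form: "\<not> p dvd kap T * s"
    and not_dvd_D_factor_if_dvd_B_form:
      "modulus T dvd kap T * s \<Longrightarrow> (g, e) \<in> set (D_factors T) \<Longrightarrow> \<not> p dvd form g s b"
proof -
  obtain cs where cs: "B_form T = 1 # cs" "list_all (\<lambda>c. kap T dvd c) cs"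
    using B_form_kap [of T] length_forms(2) [of T] by (cases "B_form T") auto
  show nd: "\<not> p dvd kap T * s"
  proof
    assume dvd: "p dvd kap T * s"
    then have "p dvd s * form cs s b"
      using assms(1) dvd_form [OF cs(2), of s b] by (auto simp: prime_dvd_mult_iff dvd_trans)
    then have "p dvd b ^ length cs"
      using assms(2) cs(1) by (simp add: dvd_add_left_iff)
    then have "p dvd b"
      using assms(1) prime_dvd_power by blast
    with dvd assms(1,3) show False
      using not_prime_unit coprime_common_divisor by blast
  qed
  assume M: "modulus T dvd kap T * s" and g: "(g, e) \<in> set (D_factors T)"
  show "\<not> p dvd form g s b"
  proof
    assume pg: "p dvd form g s b"
    obtain u where u: "((g, e), u) \<in> set (zip (D_factors T) (B_inverses T))"
      using g length_B_inverses [of T] by (metis in_set_impl_in_set_zip1)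
    define r where "r = frem (tl g) (fmul u (B_form T))"
    have r: "r \<noteq> []" "list_all ((=) 0) (butlast r)" "last r dvd modulus T ^ 24"
      using D_factors_resultant [of T] u by (auto simp: list_all_iff Let_def r_def)
    have "g = 1 # tl g"
      using g D_factors_ne [of T] D_factors_monic [of T]
      by (cases g) (auto simp: list_all_iff image_iff)
    then obtain k where "form g s b dvd form (fmul u (B_form T)) s b - s ^ k * form r s b"
      using form_frem [of "tl g" s b "fmul u (B_form T)"] by (auto simp: r_def)
    then have "p dvd form u s b * form (B_form T) s b - s ^ k * form r s b"
      using pg dvd_trans by (simp add: form_fmul length_forms) blast
    then have "p dvd s ^ k * form r s b"
      using assms(2) by (simp add: dvd_diff_right_iff)
    then have "p dvd s ^ k * (s ^ (length r - 1) * last r)"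
      using r by (simp add: form_last)
    then have "p dvd s \<or> p dvd last r"
      using assms(1) by (auto simp: prime_dvd_mult_iff dest: prime_dvd_power)
    moreover have "p dvd kap T * s" if "p dvd last r"
      using that r(3) assms(1) M by (meson dvd_trans prime_dvd_power)
    ultimately show False
      using nd by auto
  qed
qed

lemma D_factors_split:
  obtains e1 e2 fs where "D_factors T = ([1, 0], e1) # ([1, kap T], e2) # fs"
proof -
  obtain f1 f2 fs where "D_factors T = f1 # f2 # fs"
    using D_factors_take_2 [of T] by (cases "D_factors T"; cases "tl (D_factors T)") auto
  moreover from this have "fst f1 = [1, 0]" "fst f2 = [1, kap T]"
    using D_factors_take_2 [of T] by auto
  ultimately show ?thesis
    using that by (metis prod.collapse)
qed

lemma form_R_form: "form (R_form T) s b = (\<Prod>(g, e)\<leftarrow>drop 2 (D_factors T). form g s b)"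
proof -
  have "[] \<notin> set (map fst (drop 2 (D_factors T)))"
    using D_factors_ne [of T] set_drop_subset [of 2 "D_factors T"] by auto
  then show ?thesis
    by (simp add: R_form_def form_fprod o_def case_prod_unfold)
qed

text \<open>Both summands of \<open>H_form\<close> have the same length, so \<open>fadd\<close>
  introduces no power of \<open>b\<close>.\<close>

lemma form_H_form:
  "form (H_form T) s b
     = (form (A_form T) s b)\<^sup>2 - (b + of_int (kap T) * s) * (form (R_form T) s b * form (B_form T) s b)"
  using length_forms [of T]
  by (simp add: H_form_def form_fadd form_fmul form_map_mult power2_eq_square algebra_simps
      del: fmul.simps)

lemma prime_dvd_D_factors:
  fixes s b :: int
  assumes "prime p" "p dvd s ^ i * (\<Prod>(g, e)\<leftarrow>fs. form g s b ^ e)"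
  shows "p dvd s \<or> (\<exists>(g, e)\<in>set fs. p dvd form g s b)"
proof -
  have "\<exists>(g, e)\<in>set fs. p dvd form g s b" if "p dvd (\<Prod>(g, e)\<leftarrow>fs. form g s b ^ e)"
    using that assms(1) by (induction fs) (auto simp: prime_dvd_mult_iff dest: prime_dvd_power)
  then show ?thesis
    using assms by (auto simp: prime_dvd_mult_iff dest: prime_dvd_power)
qed

lemma modulus_dvd:
  assumes "[a = 0] (mod 6)" "T = C10 \<Longrightarrow> [a = 0] (mod 5)" "T = C7 \<Longrightarrow> [a = 0] (mod 7)"
  shows "modulus T dvd a"
proof -
  have "30 dvd a" if "6 dvd a" "5 dvd a" using that by presburger
  moreover have "42 dvd a" if "6 dvd a" "7 dvd a" using that by presburger
  ultimately show ?thesis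
    using assms by (cases T) (auto simp: cong_0_iff)
qed

lemma abc_step:
  fixes a b c :: int
  assumes pos: "positive_abc_triple a b c" and good: "good_abc_triple a b c"
    and bound: "of_int b / of_int a > delta_T T"
    and six: "[a = 0] (mod 6)"
    and five: "T = C10 \<Longrightarrow> [a = 0] (mod 5)" and seven: "T = C7 \<Longrightarrow> [a = 0] (mod 7)"
  obtains a' b' c' :: int where
    "1728 * D_poly T (of_int a) (of_int b) = of_int a'"
    "(B_poly T (of_int a) (of_int b))\<^sup>2 = of_int b'"
    "A_poly T (of_int a) (of_int b) ^ 3 = of_int c'"
    "of_int b' / of_int a' > delta_T T"
    "[a' = 0] (mod 6)" "T = C10 \<longrightarrow> [a' = 0] (mod 5)" "T = C7 \<longrightarrow> [a' = 0] (mod 7)"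
    "positive_abc_triple a' b' c'" "good_abc_triple a' b' c'"
proof -
  have a: "a > 0" and b: "b > 0" and c: "c > 0" "a + b = c" and "gcd a (gcd b c) = 1"
    using pos by (auto simp: positive_abc_triple_def abc_triple_def)
  have "gcd a b dvd gcd a (gcd b c)"
    unfolding c(2) [symmetric] by (intro gcd_greatest dvd_add) auto
  then have cop: "coprime a b"
    using \<open>gcd a (gcd b c) = 1\<close> by (simp add: coprime_iff_gcd_eq_1)
  have M: "modulus T dvd a" by (rule modulus_dvd) (use six five seven in auto)
  \<comment> \<open>For \<open>C10\<close> this uses that 6 divides \<open>a\<close>; integrality of
    \<open>s\<close> makes the next triple integral.\<close>
  have "kap T dvd a"
    using six by (cases T) (auto simp: cong_0_iff dvd_trans [of 2 6])
  then obtain s where s: "a = kap T * s" by blast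
  have "s > 0" using a kap_pos [of T] by (simp add: s zero_less_mult_iff)
  define x :: real where "x = of_int b / of_int a"
  have x: "x > delta_T T" "x > slope_bound T" "x > 0"
    using bound slope_bound_less_delta_T [of T] slope_bound_pos [of T] by (auto simp: x_def)
  define \<alpha> where "\<alpha> = form (A_form T) s b"
  define \<beta> where "\<beta> = form (B_form T) s b"
  define \<rho> where "\<rho> = form (R_form T) s b"
  define d where "d = s ^ a_mult T * (\<Prod>(g, e)\<leftarrow>D_factors T. form g s b ^ e)"
  have ra: "real_of_int a = of_int (kap T) * of_int s" by (simp add: s)
  have A: "A_poly T (of_int a) (of_int b) = of_int \<alpha>"
    and B: "B_poly T (of_int a) (of_int b) = - of_int \<beta>"
    unfolding ra A_poly_eq_form B_poly_eq_form by (simp_all add: \<alpha>_def \<beta>_def of_int_form)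
  have "real_of_int (\<Prod>(g, e)\<leftarrow>fs. form g s b ^ e) = (\<Prod>(g, e)\<leftarrow>fs. form g (of_int s) (of_int b) ^ e)" for fs
    by (induction fs) (auto simp: of_int_form)
  then have D: "D_poly T (of_int a) (of_int b) = of_int d"
    unfolding ra D_poly_eq_prod by (simp add: d_def)
  have hyps: "real_of_int s > 0" "of_int b / (of_int (kap T) * real_of_int s) > slope_bound T"
    using x \<open>s > 0\<close> by (simp_all add: x_def s)
  have "real_of_int d > 0"
    using D_poly_pos [OF hyps] by (simp add: D flip: ra)
  then have "d > 0" by simp
  have "\<beta> > 0"
    using B_form_pos [OF hyps] by (simp add: \<beta>_def flip: of_int_form)
  have gpos: "form g s b > 0" if "(g, e) \<in> set (D_factors T)" for g e
    using D_factor_pos [OF hyps that] by (simp flip: of_int_form)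
  have "(\<Prod>(g, e)\<leftarrow>fs. form g s b) > 0" if "set fs \<subseteq> set (D_factors T)" for fs
    using that gpos by (induction fs) auto
  then have "\<rho> > 0"
    by (simp add: \<rho>_def form_R_form set_drop_subset)
  have cs: "b + kap T * s = c" using c s by simp
  have "form (H_form T) s b \<ge> 0"
    using H_form_nonneg [OF hyps] by (simp flip: of_int_form)
  then have H: "c * (\<rho> * \<beta>) \<le> \<alpha>\<^sup>2"
    by (simp add: form_H_form cs \<alpha>_def \<beta>_def \<rho>_def)
  have "real_of_int (\<alpha> ^ 3) = of_int (\<beta>\<^sup>2 + 1728 * d)"
    using A_poly_cubed [of T "of_int a" "of_int b"] by (simp add: A B D)
  then have sum: "1728 * d + \<beta>\<^sup>2 = \<alpha> ^ 3"
    unfolding of_int_eq_iff by simp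
  then have "\<alpha> ^ 3 > 0"
    using \<open>d > 0\<close> by (smt (verit) zero_le_power2)
  then have "\<alpha> > 0" by (simp add: zero_less_power_eq)
  \<comment> \<open>Primes of the factor 1728 are thus already primes of \<open>a\<close>.\<close>
  have dvd_a: "p dvd a" if "prime p" "p dvd 1728" for p :: int
  proof -
    have "1728 dvd (6 ^ 6 :: int)" by simp
    with that have "p dvd 6"
      using dvd_trans prime_dvd_power by metis
    moreover have "6 dvd a" using six by (simp only: cong_0_iff)
    ultimately show ?thesis by (rule dvd_trans)
  qed
  have cop': "coprime (kap T * s) b" using cop by (simp add: s)
  have "coprime (1728 * d) \<beta>"
  proof (rule ccontr)
    assume "\<not> coprime (1728 * d) \<beta>"
    then obtain k where k: "k dvd 1728 * d" "k dvd \<beta>" "\<not> k dvd 1"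
      by (rule not_coprimeE)
    moreover have "k \<noteq> 0" using k(2) \<open>\<beta> > 0\<close> by auto
    ultimately obtain p where p: "prime p" "p dvd 1728 * d" "p dvd \<beta>"
      using prime_divisor_exists [of k] by (auto dest: dvd_trans)
    have np: "\<not> p dvd kap T * s"
      using not_dvd_if_dvd_B_form [OF p(1) _ cop'] p(3) by (simp add: \<beta>_def)
    have "p dvd d"
      using p(2) dvd_a [OF p(1)] np unfolding s prime_dvd_mult_iff [OF p(1)] by blast
    then consider "p dvd s" | g e where "(g, e) \<in> set (D_factors T)" "p dvd form g s b"
      using prime_dvd_D_factors [OF p(1)] unfolding d_def by blast
    then show False
    proof cases
      case 1
      with np show False by simp
    next
      case 2
      then show False
        using not_dvd_D_factor_if_dvd_B_form [OF p(1) _ cop'] p(3) M by (simp add: \<beta>_def s)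
    qed
  qed
  then have "coprime (1728 * d) (\<beta>\<^sup>2)"
    by (simp only: coprime_power_right_iff simp_thms)
  then have "coprime (1728 * d) (gcd (\<beta>\<^sup>2) (\<alpha> ^ 3))"
    by (rule coprime_divisors [OF dvd_refl gcd_dvd1])
  then have "gcd (1728 * d) (gcd (\<beta>\<^sup>2) (\<alpha> ^ 3)) = 1"
    by (simp only: coprime_iff_gcd_eq_1)
  with sum have triple: "abc_triple (1728 * d) (\<beta>\<^sup>2) (\<alpha> ^ 3)"
    unfolding abc_triple_def by (rule conjI)
  then have abc: "positive_abc_triple (1728 * d) (\<beta>\<^sup>2) (\<alpha> ^ 3)"
    unfolding positive_abc_triple_def using \<open>d > 0\<close> \<open>\<beta> > 0\<close> \<open>\<alpha> > 0\<close> by (intro conjI) simp_all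
  have "rad (1728 * d * \<beta>\<^sup>2 * \<alpha> ^ 3) \<le> rad (a * b * c) * (\<rho> * \<beta> * \<alpha>)"
  proof (rule rad_le_rad_mult)
    fix p :: int assume p: "prime p" "p dvd 1728 * d * \<beta>\<^sup>2 * \<alpha> ^ 3"
    then consider "p dvd 1728" | "p dvd d" | "p dvd \<beta>" | "p dvd \<alpha>"
      using prime_dvd_power [OF p(1)] unfolding prime_dvd_mult_iff [OF p(1)] by blast
    then show "p dvd a * b * c \<or> p dvd \<rho> * \<beta> * \<alpha>"
    proof cases
      case 1
      then show ?thesis using dvd_a [OF p(1)] by simp
    next
      case 2
      then consider "p dvd s" | g e where "(g, e) \<in> set (D_factors T)" "p dvd form g s b"
        using prime_dvd_D_factors [OF p(1)] unfolding d_def by blast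
      then show ?thesis
      proof cases
        case 1
        then show ?thesis by (simp add: s)
      next
        case 2
        \<comment> \<open>A prime of the first factor divides \<open>b\<close>, one of the second
          divides \<open>c\<close>, and one of any other factor divides
          \<open>\<rho>\<close>.\<close>
        obtain e1 e2 fs where fs: "D_factors T = ([1, 0], e1) # ([1, kap T], e2) # fs"
          by (rule D_factors_split)
        have "p dvd (\<Prod>(g, e)\<leftarrow>fs. form g s b)" if "(g, e) \<in> set fs"
          using that 2(2) by (induction fs) auto
        then have rest: "p dvd \<rho>" if "(g, e) \<in> set fs"
          using that by (simp add: \<rho>_def form_R_form fs)
        consider "g = [1, 0]" | "g = [1, kap T]" | "(g, e) \<in> set fs"
          using 2(1) fs by auto
        then show ?thesis
        proof cases
          case 1
          with 2(2) have "p dvd b" by simp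
          then show ?thesis by simp
        next
          case 2
          with \<open>p dvd form g s b\<close> have "p dvd c"
            unfolding cs [symmetric] by (simp add: mult.commute)
          then show ?thesis by simp
        next
          case 3
          with rest show ?thesis by simp
        qed
      qed
    qed auto
  qed (use a b c \<open>\<rho> > 0\<close> \<open>\<beta> > 0\<close> \<open>\<alpha> > 0\<close> in auto)
  also have "rad (a * b * c) < c"
  proof -
    have "Max {\<bar>a\<bar>, \<bar>b\<bar>, \<bar>c\<bar>} = c" using a b c by (intro Max_eqI) auto
    then show ?thesis using good by (simp add: good_abc_triple_def)
  qed
  then have "rad (a * b * c) * (\<rho> * \<beta> * \<alpha>) < c * (\<rho> * \<beta> * \<alpha>)"
    using \<open>\<rho> > 0\<close> \<open>\<beta> > 0\<close> \<open>\<alpha> > 0\<close> by simp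
  also have "\<dots> \<le> \<alpha>\<^sup>2 * \<alpha>"
    using mult_right_mono [OF H, of \<alpha>] \<open>\<alpha> > 0\<close> by (simp add: mult_ac)
  finally have "rad (1728 * d * \<beta>\<^sup>2 * \<alpha> ^ 3) < \<alpha> ^ 3"
    by (simp add: power2_eq_square power3_eq_cube)
  moreover have "Max {\<bar>1728 * d\<bar>, \<bar>\<beta>\<^sup>2\<bar>, \<bar>\<alpha> ^ 3\<bar>} = \<alpha> ^ 3"
    using sum \<open>d > 0\<close> \<open>\<alpha> ^ 3 > 0\<close> by (intro Max_eqI) (auto simp: sum [symmetric])
  ultimately have gd: "good_abc_triple (1728 * d) (\<beta>\<^sup>2) (\<alpha> ^ 3)"
    unfolding good_abc_triple_def using triple by (simp only:)
  \<comment> \<open>By homogeneity the new ratio exceeds the old ratio \<open>x\<close>, because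
    \<open>f_T\<close> is positive at \<open>x\<close>.\<close>
  have "delta_T T < of_int (\<beta>\<^sup>2) / of_int (1728 * d)"
  proof -
    define k where "k = real_of_int a"
    have "k > 0" using a by (simp add: k_def)
    have kx: "k * x = of_int b" using a by (simp add: k_def x_def)
    have "- of_int \<beta> = k ^ (length (B_form T) - 1) * B_poly T 1 x"
      using B_poly_scale [of T k 1 x] B unfolding kx by (simp add: k_def)
    then have "(- real_of_int \<beta>)\<^sup>2 = (k ^ (length (B_form T) - 1) * B_poly T 1 x)\<^sup>2"
      by (rule arg_cong)
    then have B1: "(of_int \<beta>)\<^sup>2 = k ^ (2 * (length (B_form T) - 1)) * (B_poly T 1 x)\<^sup>2"
      unfolding power2_minus power_mult_distrib power_even_eq .
    have D1: "of_int d = k ^ (2 * (length (B_form T) - 1)) * D_poly T 1 x"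
      using D_poly_scale [of T k 1 x] D unfolding kx by (simp add: k_def)
    have "1728 * x * of_int d < (of_int \<beta>)\<^sup>2"
      using mult_strict_left_mono [OF f_T_pos_beyond_delta_T [OF x(1)],
          of "k ^ (2 * (length (B_form T) - 1))"] \<open>k > 0\<close>
      unfolding B1 D1 by (simp add: mult_ac)
    then have "x < of_int (\<beta>\<^sup>2) / of_int (1728 * d)"
      using \<open>d > 0\<close> by (simp add: field_simps)
    with x(1) show ?thesis by simp
  qed
  moreover have "[1728 * d = 0] (mod 6)" by (simp add: cong_0_iff)
  \<comment> \<open>Used for 5 and 7: as \<open>d\<close> contains a power of \<open>s\<close>
    rather than of \<open>a\<close>, the prime must not divide \<open>kap T\<close>.\<close>
  moreover have "q dvd 1728 * d" if "prime q" "q dvd a" "\<not> q dvd kap T" for q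
  proof -
    have "q dvd s" using that s by (auto simp: prime_dvd_mult_iff)
    moreover have "s dvd s ^ a_mult T" using length_forms(6) [of T] by (intro dvd_power) simp
    ultimately have "q dvd s ^ a_mult T" by (rule dvd_trans)
    then show ?thesis by (simp add: d_def)
  qed
  then have "T = C10 \<longrightarrow> [1728 * d = 0] (mod 5)" "T = C7 \<longrightarrow> [1728 * d = 0] (mod 7)"
    using five seven by (auto simp: cong_0_iff)
  ultimately show ?thesis
    using that [of "1728 * d" "\<beta>\<^sup>2" "\<alpha> ^ 3"] A B D abc gd by simp
qed

theorem theorem4p8:
  fixes T :: torsion and a0 b0 c0 :: int
  assumes "positive_abc_triple a0 b0 c0"
    and "good_abc_triple a0 b0 c0"
    and "[a0 = 0] (mod 6)"
    and "real_of_int b0 / real_of_int a0 > delta_T T"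
    and "T = C10 \<Longrightarrow> [a0 = 0] (mod 5)"
    and "T = C7 \<Longrightarrow> [a0 = 0] (mod 7)"
  shows "\<forall>n. \<exists>a b c :: int.
           P_seq T (real_of_int a0, real_of_int b0, real_of_int c0) n
             = (real_of_int a, real_of_int b, real_of_int c) \<and>
           real_of_int b / real_of_int a > delta_T T \<and>
           [a = 0] (mod 6) \<and>
           (T = C10 \<longrightarrow> [a = 0] (mod 5)) \<and>
           (T = C7 \<longrightarrow> [a = 0] (mod 7)) \<and>
           positive_abc_triple a b c \<and> good_abc_triple a b c"
proof
  fix n
  show "\<exists>a b c :: int.
           P_seq T (real_of_int a0, real_of_int b0, real_of_int c0) n
             = (real_of_int a, real_of_int b, real_of_int c) \<and>
           real_of_int b / real_of_int a > delta_T T \<and>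
           [a = 0] (mod 6) \<and>
           (T = C10 \<longrightarrow> [a = 0] (mod 5)) \<and>
           (T = C7 \<longrightarrow> [a = 0] (mod 7)) \<and>
           positive_abc_triple a b c \<and> good_abc_triple a b c"
  proof (induction n)
    case 0
    show ?case
      using assms by (intro exI [of _ a0] exI [of _ b0] exI [of _ c0]) simp
  next
    case (Suc n)
    then obtain a b c :: int where
      P: "P_seq T (of_int a0, of_int b0, of_int c0) n = (of_int a, of_int b, of_int c)"
      and hyps: "positive_abc_triple a b c" "good_abc_triple a b c"
        "of_int b / of_int a > delta_T T" "[a = 0] (mod 6)"
        "T = C10 \<Longrightarrow> [a = 0] (mod 5)" "T = C7 \<Longrightarrow> [a = 0] (mod 7)"
      by blast
    obtain a' b' c' :: int where
      "1728 * D_poly T (of_int a) (of_int b) = of_int a'"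
      "(B_poly T (of_int a) (of_int b))\<^sup>2 = of_int b'"
      "A_poly T (of_int a) (of_int b) ^ 3 = of_int c'"
      "of_int b' / of_int a' > delta_T T"
      "[a' = 0] (mod 6)" "T = C10 \<longrightarrow> [a' = 0] (mod 5)" "T = C7 \<longrightarrow> [a' = 0] (mod 7)"
      "positive_abc_triple a' b' c'" "good_abc_triple a' b' c'"
      using abc_step [OF hyps] by blast
    with P show ?case
      by (intro exI [of _ a'] exI [of _ b'] exI [of _ c']) simp
  qed
qed

end
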